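(* Let $C$ be a copula on $\mathbb{R}^d$ and let $\bm U^{(1)},\bm U^{(2)},\dots$ be independent random vectors with distribution function $C$. Suppose that $C$ satisfies, for some $\delta>0$ and some $D$-norm $\|\cdot\|_D$ on $\mathbb{R}^d$, $$C(\bm u)-\bigl(1-\|\bm u-\bm 1\|_D\bigr)=O\bigl(\|\bm u-\bm 1\|_D^{1+\delta}\bigr)\quad\text{as }\bm u\uparrow\bm 1 .$$ Let $k\in\mathbb{N}$ be fixed and let $c_n\in(0,1)$ satisfy $c_n\to0$, $nc_n\to\infty$ and $nc_n^{1+2\delta}\to0$ as $n\to\infty$. Then $$T_n(c_n)\to_D\sum_{i=1}^{k-1}\lambda_i\xi_i^2\quad\text{as } n\to\infty,$$ where $\xi_1,\dots,\xi_{k-1}$ are independent standard normal random variables and $$\lambda_i=\frac1{4\sin^2\left(\frac ik\frac\pi2\right)},\qquad 1\le i\le k-1 .$$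
   Context: $\bm 1=(1,\dots,1)^\top\in\mathbb{R}^d$, and $\to_D$ denotes convergence in distribution. The limit $\bm u\uparrow\bm 1$ is over $\bm u\in[0,1]^d$, and the $O$ is uniform. A norm $\|\cdot\|_D$ on $\mathbb{R}^d$ is called a $D$-norm if there is a copula $C$ on $\mathbb{R}^d$ with $C(\bm u)=1-\|\bm u-\bm 1\|_D+o(\|\bm u-\bm 1\|_D)$ uniformly for $\bm u\in[0,1]^d$ as $\bm u\uparrow\bm 1$. (The displayed $O$-condition on $C$ already implies this expansion for $C$.) For a random vector $\bm U=(U_1,\dots,U_d)^\top$ and $s<0$ put $S_{\bm U}(s):=\sum_{i=1}^d 1_{(s,\infty)}(U_i-1)$. For $0<c<1$ and $1\le j\le k$ put $$n_j(c):=\sum_{i=1}^n1_{(0,\infty)}\Bigl(S_{\bm U^{(i)}}\Bigl(-\frac cj\Bigr)\Bigr),$$ i.e. the number of those $\bm U^{(i)}$, $1\le i\le n$, having at least one component exceeding $1-\frac cj$. The test statistic is $$T_n(c):=\frac{\sum_{j=1}^k\left(j\,n_j(c)-\frac1k\sum_{\ell=1}^k\ell\,n_\ell(c)\right)^2}{\frac1k\sum_{\ell=1}^k\ell\,n_\ell(c)} .$$ *)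

theory Defs
  imports "HOL-Probability.Probability" "HOL-Library.Landau_Symbols"
begin

text \<open>
  The order on \<^typ>\<open>real ^ 'd\<close> is componentwise, so \<^term>\<open>{..u}\<close> is the lower orthant with
  corner \<open>u\<close>, \<^term>\<open>{0..1 :: real ^ 'd}\<close> is the unit cube, and \<^term>\<open>1 :: real ^ 'd\<close> is the
  vector with all components equal to 1.
\<close>

definition mv_cdf :: "(real ^ 'd) measure \<Rightarrow> real ^ 'd \<Rightarrow> real" where
  "mv_cdf \<mu> u = measure \<mu> {..u}"

definition copula :: "(real ^ 'd \<Rightarrow> real) \<Rightarrow> bool" where
  "copula C \<longleftrightarrow>
    (\<exists>\<mu>. prob_space \<mu> \<and> sets \<mu> = sets borel \<and> mv_cdf \<mu> = C \<and>
         (\<forall>i. distr \<mu> borel (\<lambda>x. x $ i) = uniform_measure lborel {0..1}))"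

definition is_norm :: "('a :: real_vector \<Rightarrow> real) \<Rightarrow> bool" where
  "is_norm N \<longleftrightarrow>
    (\<forall>x. 0 \<le> N x) \<and> (\<forall>x. N x = 0 \<longleftrightarrow> x = 0) \<and>
    (\<forall>a x. N (a *\<^sub>R x) = \<bar>a\<bar> * N x) \<and> (\<forall>x y. N (x + y) \<le> N x + N y)"

text \<open>
  Uniformity in \<open>u\<close> is expressed by taking the limit along the full neighbourhood filter of
  \<open>1\<close> within the unit cube.
\<close>

definition D_norm :: "(real ^ 'd \<Rightarrow> real) \<Rightarrow> bool" where
  "D_norm N \<longleftrightarrow> is_norm N \<and>
    (\<exists>C. copula C \<and>
      (\<lambda>u. C u - (1 - N (u - 1))) \<in> o[at 1 within {0..1}](\<lambda>u. N (u - 1)))"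

definition exceedances :: "real ^ 'd \<Rightarrow> real \<Rightarrow> real" where
  "exceedances x s = (\<Sum>i\<in>UNIV. indicator {s<..} (x $ i - 1))"

text \<open>
  In the next two definitions \<open>X\<close> is the realised sample \<open>X 1, X 2, \<dots>\<close>, of which only
  \<open>X 1, \<dots>, X n\<close> are used.
\<close>

definition exceedance_count :: "(nat \<Rightarrow> real ^ 'd) \<Rightarrow> nat \<Rightarrow> real \<Rightarrow> nat \<Rightarrow> real" where
  "exceedance_count X n c j =
    (\<Sum>i=1..n. indicator {0<..} (exceedances (X i) (- c / real j)))"

text \<open>
  If no observation exceeds any threshold, the quotient is \<open>0 / 0\<close>, which is \<open>0\<close> here.
\<close>

definition T_stat :: "nat \<Rightarrow> nat \<Rightarrow> real \<Rightarrow> (nat \<Rightarrow> real ^ 'd) \<Rightarrow> real" where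
  "T_stat k n c X =
    (let m = 1 / real k * (\<Sum>l=1..k. real l * exceedance_count X n c l)
     in (\<Sum>j=1..k. (real j * exceedance_count X n c j - m)\<^sup>2) / m)"

end

theory Submission imports Defs begin

text \<open>
  Put \<open>a n = n * c n * N 1\<close>. Since \<open>exp (- x)\<close> takes values in \<open>[0, 1]\<close> for \<open>x \<ge> 0\<close>, Weierstrass approximation in the
  variable \<open>exp (- x)\<close> reduces the claim to convergence of the Laplace transforms of \<open>T n\<close> at natural numbers.
  The denominator of \<open>T n\<close>, divided by \<open>a n\<close>, tends to \<open>1\<close> in \<open>L\<^sup>1\<close>, and \<open>exp (- (s * Q / R))\<close> is Lipschitz in \<open>R\<close>
  near \<open>1\<close> uniformly in \<open>Q \<ge> 0\<close>, so it may be replaced by \<open>a n\<close>. In the discrete cosine basis, the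
  numerator becomes a sum of squares of linear scores \<open>L\<^sub>i\<close>, \<open>1 \<le> i \<le> k - 1\<close>. Because \<open>exp (- (s * L\<^sup>2))\<close> is the mean
  of \<open>exp (\<i> * sqrt (2 * s) * \<xi> * L)\<close> over a standard normal \<open>\<xi>\<close>, Fubini with the very \<open>\<xi>\<^sub>i\<close> of the limit law turns
  the Laplace transform into an average of characteristic functions of linear combinations of scores.
  These are row sums of bounded independent variables, whose characteristic functions converge; the limit covariance
  of \<open>j * n\<^sub>j / sqrt (a n)\<close> is \<open>min i j\<close>, and the cosine basis diagonalises its centred version with
  eigenvalues \<open>\<lambda>\<^sub>i\<close>. The condition on \<open>n * c n powr (1 + 2 * \<delta>)\<close> makes the bias negligible.
\<close>

subsection \<open>Laplace transforms and weak convergence\<close>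

text \<open>With \<open>y = exp (- x)\<close>, the continuous step functions that test weak
  convergence become continuous functions of \<open>y\<close> on the unit interval, because they
  vanish for large \<open>x\<close>. Polynomials in \<open>y\<close> approximate these uniformly,
  and their integrals are finite combinations of Laplace transforms at natural numbers.\<close>

lemma weak_conv_m_of_laplace:
  fixes \<mu> :: "nat \<Rightarrow> real measure" and \<nu> :: "real measure"
  assumes \<mu>: "\<And>n. real_distribution (\<mu> n)" and \<nu>: "real_distribution \<nu>"
    and \<mu>_nonneg: "\<And>n. AE x in \<mu> n. 0 \<le> x" and \<nu>_nonneg: "AE x in \<nu>. 0 \<le> x"
    and lim: "\<And>s::nat. (\<lambda>n. \<integral>x. exp (- (real s * x)) \<partial>\<mu> n) \<longlonglongrightarrow> (\<integral>x. exp (- (real s * x)) \<partial>\<nu>)"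
  shows "weak_conv_m \<mu> \<nu>"
proof (rule integral_cts_step_conv_imp_weak_conv[OF \<mu> \<nu>])
  fix a b :: real assume ab: "a < b"
  \<comment> \<open>The truncation at \<open>exp (- b)\<close> keeps the logarithm away from 0, so
    \<open>g\<close> is continuous up to \<open>y = 0\<close>; nothing is lost, since
    \<open>cts_step a b\<close> vanishes from \<open>b\<close> on.\<close>
  define g where "g y = cts_step a b (- ln (max y (exp (- b))))" for y
  have cts: "continuous_on UNIV (cts_step a b)"
    by (rule uniformly_continuous_imp_continuous[OF cts_step_uniformly_continuous[OF ab]])
  have mx: "0 < max y (exp (- b))" for y :: real
    by (simp add: less_max_iff_disj)
  have "continuous_on {0..1} g"
    unfolding g_def
    by (intro continuous_on_compose2[OF cts] continuous_intros) (use mx in \<open>auto simp: less_imp_neq[symmetric]\<close>)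
  have g_exp: "g (exp (- x)) = cts_step a b x" for x
  proof (cases "x \<le> b")
    case True then show ?thesis by (simp add: g_def max_absorb1)
  next
    case False then show ?thesis using ab by (simp add: g_def max_absorb2 cts_step_def)
  qed
  show "(\<lambda>n. integral\<^sup>L (\<mu> n) (cts_step a b)) \<longlonglongrightarrow> integral\<^sup>L \<nu> (cts_step a b)"
  proof (rule LIMSEQ_I)
    fix e :: real assume e: "0 < e"
    obtain q where q: "real_polynomial_function q" "\<And>y. y \<in> {0..1} \<Longrightarrow> \<bar>g y - q y\<bar> < e / 3"
      using Stone_Weierstrass_real_polynomial_function[OF compact_Icc \<open>continuous_on {0..1} g\<close>, of "e/3"] e
      by auto
    obtain co d where qs: "q = (\<lambda>y. \<Sum>i\<le>d. co i * y ^ i)"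
      using q(1) real_polynomial_function_iff_sum by metis
    define P where "P x = (\<Sum>i\<le>d. co i * exp (- (real i * x)))" for x
    have Pq: "P x = q (exp (- x))" for x
      by (simp add: P_def qs exp_of_nat_mult[symmetric])
    have int: "integrable \<rho> (\<lambda>x. exp (- (real i * x)))"
      if "real_distribution \<rho>" "AE x in \<rho>. 0 \<le> x" for \<rho> i
    proof -
      interpret real_distribution \<rho> by fact
      show ?thesis
        using that(2) by (intro integrable_const_bound[where B=1]) (auto elim!: eventually_mono)
    qed
    \<comment> \<open>One polynomial serves every law on the half-line, so this bound covers all
      \<open>\<mu> n\<close> and \<open>\<nu>\<close> at once; it supplies two of the three thirds
      of \<open>e\<close>.\<close>
    have bound: "\<bar>integral\<^sup>L \<rho> (cts_step a b) - integral\<^sup>L \<rho> P\<bar> \<le> e / 3"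
      if \<rho>: "real_distribution \<rho>" "AE x in \<rho>. 0 \<le> x" for \<rho>
    proof -
      interpret real_distribution \<rho> by fact
      have iP: "integrable \<rho> P"
        unfolding P_def by (intro Bochner_Integration.integrable_sum integrable_mult_right int \<rho>)
      have "AE x in \<rho>. \<bar>cts_step a b x - P x\<bar> \<le> e / 3"
        using \<rho>(2)
      proof eventually_elim
        case (elim x)
        then show ?case using q(2)[of "exp (- x)"] by (simp add: g_exp Pq)
      qed
      then have "(\<integral>x. \<bar>cts_step a b x - P x\<bar> \<partial>\<rho>) \<le> (\<integral>x. e / 3 \<partial>\<rho>)"
        by (intro integral_mono_AE) (auto intro!: integrable_diff iP integrable_cts_step ab)
      moreover have "integral\<^sup>L \<rho> (cts_step a b) - integral\<^sup>L \<rho> P = (\<integral>x. cts_step a b x - P x \<partial>\<rho>)"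
        by (intro Bochner_Integration.integral_diff[symmetric] iP integrable_cts_step ab)
      moreover have "(\<integral>x. e / 3 \<partial>\<rho>) = e / 3" using prob_space by simp
      ultimately show ?thesis
        using integral_abs_bound[of \<rho> "\<lambda>x. cts_step a b x - P x"] by linarith
    qed
    have iP: "integral\<^sup>L \<rho> P = (\<Sum>i\<le>d. co i * (\<integral>x. exp (- (real i * x)) \<partial>\<rho>))"
      if "real_distribution \<rho>" "AE x in \<rho>. 0 \<le> x" for \<rho>
      unfolding P_def by (subst Bochner_Integration.integral_sum) (auto intro!: int that)
    have "(\<lambda>n. integral\<^sup>L (\<mu> n) P) \<longlonglongrightarrow> integral\<^sup>L \<nu> P"
      by (simp add: iP \<mu> \<nu> \<mu>_nonneg \<nu>_nonneg) (intro tendsto_intros lim)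
    then obtain n0 where n0: "\<And>n. n \<ge> n0 \<Longrightarrow> \<bar>integral\<^sup>L (\<mu> n) P - integral\<^sup>L \<nu> P\<bar> < e / 3"
      using LIMSEQ_D[of _ _ "e/3"] e by fastforce
    have "norm (integral\<^sup>L (\<mu> n) (cts_step a b) - integral\<^sup>L \<nu> (cts_step a b)) < e" if "n \<ge> n0" for n
    proof -
      have "\<bar>integral\<^sup>L (\<mu> n) P - integral\<^sup>L \<nu> P\<bar> < e / 3" by (rule n0[OF that])
      with bound[OF \<mu> \<mu>_nonneg, of n] bound[OF \<nu> \<nu>_nonneg] show ?thesis
        unfolding real_norm_def by linarith
    qed
    then show "\<exists>n0. \<forall>n\<ge>n0. norm (integral\<^sup>L (\<mu> n) (cts_step a b) - integral\<^sup>L \<nu> (cts_step a b)) < e"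
      by blast
  qed
qed

text \<open>The case \<open>R = 0\<close> relies on \<open>Q / 0 = 0\<close>, as does the test statistic.\<close>

lemma exp_quotient_bound:
  fixes s Q R :: real
  assumes "0 \<le> s" "0 \<le> Q" "0 \<le> R"
  shows "\<bar>exp (- (s * (Q / R))) - exp (- (s * Q))\<bar> \<le> 2 * \<bar>R - 1\<bar>"
proof -
  define x where "x = s * Q"
  have x: "0 \<le> x" using assms by (simp add: x_def)
  have le1: "\<bar>exp (- u) - exp (- v)\<bar> \<le> 1" if "0 \<le> u" "0 \<le> v" for u v :: real
    using that by (smt (verit) exp_gt_zero exp_le_one_iff)
  \<comment> \<open>Since \<open>u * exp (- u)\<close> is at most 1, a relative increase
    \<open>r\<close> of the exponent lowers the exponential by at most \<open>r\<close>.\<close>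
  have key: "exp (- u) - exp (- v) \<le> r" if "0 \<le> u" "v = u * (1 + r)" "0 \<le> r" for u v r :: real
  proof -
    have "exp (- u) - exp (- v) = exp (- u) * (1 - exp (- (u * r)))"
      by (simp add: that(2) algebra_simps flip: exp_add)
    also have "\<dots> \<le> exp (- u) * (u * r)"
      using exp_ge_add_one_self[of "- (u * r)"] by (intro mult_left_mono) auto
    also have "\<dots> = (u * exp (- u)) * r" by simp
    also have "\<dots> \<le> 1 * r"
    proof (rule mult_right_mono)
      have "u \<le> exp u" using exp_ge_add_one_self[of u] by linarith
      then have "u * exp (- u) \<le> exp u * exp (- u)"
        by (rule mult_right_mono) simp
      then show "u * exp (- u) \<le> 1" by (simp flip: exp_add)
    qed (use that in auto)
    finally show ?thesis by simp
  qed
  \<comment> \<open>Below 1/2, including \<open>R = 0\<close>, the trivial bound 1 is enough.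
    Otherwise \<open>key\<close> applies with relative increase \<open>1 / R - 1\<close> from
    \<open>x\<close> to \<open>x / R\<close>, or \<open>R - 1\<close> from \<open>x / R\<close> to
    \<open>x\<close>; the first is at most \<open>2 * (1 - R)\<close> because \<open>R\<close> is at
    least 1/2.\<close>
  consider "R < 1/2" | "1/2 \<le> R" "R \<le> 1" | "1 \<le> R" by linarith
  then have "\<bar>exp (- (x / R)) - exp (- x)\<bar> \<le> 2 * \<bar>R - 1\<bar>"
  proof cases
    case 1
    then show ?thesis using le1[of "x / R" x] x assms by auto
  next
    case 2
    have "exp (- x) - exp (- (x / R)) \<le> 1 / R - 1"
      by (rule key) (use 2 x in \<open>auto simp: field_simps\<close>)
    moreover have "x \<le> x / R" using 2 x by (simp add: field_simps mult_left_le_one_le)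
    moreover have "1 / R - 1 \<le> 2 * (1 - R)"
    proof -
      have "1 / R - 1 = (1 - R) * (1 / R)" using 2 by (simp add: field_simps)
      also have "\<dots> \<le> (1 - R) * 2" using 2 by (intro mult_left_mono) (auto simp: field_simps)
      finally show ?thesis by simp
    qed
    ultimately show ?thesis using 2 by auto
  next
    case 3
    have "exp (- (x / R)) - exp (- x) \<le> R - 1"
      by (rule key) (use 3 x in \<open>auto simp: field_simps\<close>)
    moreover have "x / R \<le> x" using 3 mult_right_mono[of 1 R x] x by (simp add: field_simps)
    ultimately show ?thesis using 3 by auto
  qed
  then show ?thesis by (simp add: x_def)
qed

subsection \<open>The discrete cosine basis\<close>

text \<open>Multiplying by \<open>2 * sin (\<theta> / 2)\<close> makes the sum telescope (Dirichlet
  kernel). The upper end is the sine of \<open>r * pi - \<theta> / 2\<close>, so only the parity of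
  \<open>r\<close> survives. The bounds on \<open>r\<close> keep \<open>\<theta> / 2\<close> off the
  multiples of \<open>pi\<close>, where the factor would vanish.\<close>

lemma sum_cos_multiples:
  fixes r :: int
  assumes "r \<noteq> 0" "\<bar>r\<bar> < 2 * int k"
  shows "(\<Sum>i=1..k-1. cos (real i * (pi * r / k))) = (if even r then - 1 else 0)"
proof -
  have k: "k \<ge> 1" using assms by linarith
  define \<theta> where "\<theta> = pi * r / k"
  have s: "sin (\<theta> / 2) \<noteq> 0"
  proof
    assume "sin (\<theta> / 2) = 0"
    then obtain i :: int where "\<theta> / 2 = i * pi" by (auto simp: sin_zero_iff_int2)
    then have "real_of_int r = of_int (2 * int k * i)" using k by (simp add: \<theta>_def field_simps)
    then have r: "r = 2 * int k * i" by (simp only: of_int_eq_iff)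
    then have "\<bar>r\<bar> = 2 * int k * \<bar>i\<bar>" by (simp add: abs_mult)
    moreover have "\<bar>i\<bar> \<ge> 1" using r assms(1) by auto
    ultimately show False using assms(2) mult_left_mono[of 1 "\<bar>i\<bar>" "2 * int k"] by linarith
  qed
  have tel: "2 * sin (\<theta> / 2) * (\<Sum>i=1..m. cos (real i * \<theta>)) = sin ((m + 1/2) * \<theta>) - sin (\<theta> / 2)" for m :: nat
  proof (induction m)
    case (Suc m)
    have "2 * sin (\<theta> / 2) * cos (real (Suc m) * \<theta>) = sin ((Suc m + 1/2) * \<theta>) - sin ((m + 1/2) * \<theta>)"
    proof -
      have "(Suc m + 1/2) * \<theta> = real (Suc m) * \<theta> + \<theta> / 2" "(m + 1/2) * \<theta> = real (Suc m) * \<theta> - \<theta> / 2"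
        by (simp_all add: field_simps)
      then show ?thesis by (simp only: sin_add sin_diff) simp
    qed
    then show ?case using Suc by (simp add: ring_distribs)
  qed simp
  have "(real (k - 1) + 1/2) * \<theta> = real_of_int r * pi - \<theta> / 2"
    using k by (simp add: \<theta>_def of_nat_diff field_simps)
  then have "sin ((real (k - 1) + 1/2) * \<theta>) = - (cos (real_of_int r * pi) * sin (\<theta> / 2))"
    by (simp add: sin_diff sin_int_times_real mult.commute)
  moreover have "cos (real_of_int r * pi) = (if even r then 1 else - 1)"
    by (simp add: cos_int_times_real mult.commute)
  ultimately have "2 * sin (\<theta> / 2) * (\<Sum>i=1..k-1. cos (real i * \<theta>)) =
      2 * sin (\<theta> / 2) * (if even r then - 1 else 0)"
    using tel[of "k - 1"] by simp
  then have "(\<Sum>i=1..k-1. cos (real i * \<theta>)) = (if even r then - 1 else 0)"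
    using s by (simp only: mult_cancel_left) simp
  then show ?thesis unfolding \<theta>_def .
qed

text \<open>For \<open>i\<close> from 1 to \<open>k - 1\<close> these are the non-constant vectors
  of the orthonormal discrete cosine transform DCT-II, sampled at half-integers; the constant vector
  completes them to a basis.\<close>

definition dct :: "nat \<Rightarrow> nat \<Rightarrow> nat \<Rightarrow> real" where
  "dct k i j = sqrt (2 / k) * cos (i * pi * (j - 1/2) / k)"

text \<open>Eigenvalues of the covariance \<open>min i j\<close> of a random walk after centring its path.\<close>

definition rw_eigenvalue :: "nat \<Rightarrow> nat \<Rightarrow> real" where
  "rw_eigenvalue k i = 1 / (4 * (sin (real i / real k * (pi / 2)))\<^sup>2)"

text \<open>The product formula leaves two cosine sums, with \<open>r = j - j'\<close> and
  \<open>r = j + j' - 1\<close>. These have opposite parity, so off the diagonal exactly one of them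
  contributes -1. The result is the matrix of the projection onto vectors of mean zero.\<close>

lemma dct_kernel:
  assumes j: "j \<in> {1..k}" "j' \<in> {1..k}"
  shows "(\<Sum>i=1..k-1. dct k i j * dct k i j') = (if j = j' then 1 else 0) - 1 / k"
proof -
  have k: "k \<ge> 1" using j by auto
  have "dct k i j * dct k i j' =
      (cos (real i * (pi * (int j - int j') / k)) + cos (real i * (pi * (int j + int j' - 1) / k))) / k" for i
  proof -
    have half: "(sqrt (2 / k))\<^sup>2 * ((a + b) / 2) = (a + b) / k" for a b :: real
      using k by (simp add: field_simps)
    have "dct k i j * dct k i j' =
        (sqrt (2 / k))\<^sup>2 * (cos (i * pi * (j - 1/2) / k) * cos (i * pi * (j' - 1/2) / k))"
      by (simp only: dct_def power2_eq_square mult_ac)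
    also have "\<dots> = (cos (i * pi * (j - 1/2) / k - i * pi * (j' - 1/2) / k)
        + cos (i * pi * (j - 1/2) / k + i * pi * (j' - 1/2) / k)) / k"
      unfolding cos_times_cos by (rule half)
    also have "i * pi * (j - 1/2) / k - i * pi * (j' - 1/2) / k = real i * (pi * (int j - int j') / k)"
      using k by (simp add: field_simps)
    also have "i * pi * (j - 1/2) / k + i * pi * (j' - 1/2) / k = real i * (pi * (int j + int j' - 1) / k)"
      using k by (simp add: field_simps)
    finally show ?thesis .
  qed
  then have "(\<Sum>i=1..k-1. dct k i j * dct k i j') =
     ((\<Sum>i=1..k-1. cos (real i * (pi * (int j - int j') / k)))
      + (\<Sum>i=1..k-1. cos (real i * (pi * (int j + int j' - 1) / k)))) / k"
    by (simp only: sum_divide_distrib[symmetric] sum.distrib)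
  also have "(\<Sum>i=1..k-1. cos (real i * (pi * (int j + int j' - 1) / k))) =
      (if even (int j + int j' - 1) then - 1 else 0)"
    using sum_cos_multiples[of "int j + int j' - 1" k] j by simp
  also have "(\<Sum>i=1..k-1. cos (real i * (pi * (int j - int j') / k))) =
      (if j = j' then real k - 1 else if even (int j - int j') then - 1 else 0)"
    using sum_cos_multiples[of "int j - int j'" k] j k by (auto simp: of_nat_diff)
  finally show ?thesis
    using k by (auto simp: field_simps)
qed

text \<open>Both sides are the squared length of the projection of \<open>z\<close> onto the vectors
  of mean zero, expanded by \<open>dct_kernel\<close>. This turns the numerator of the test
  statistic into a sum of squares of linear functionals.\<close>

lemma dct_parseval:
  fixes z :: "nat \<Rightarrow> real"
  assumes k: "k \<ge> 1"
  shows "(\<Sum>i=1..k-1. (\<Sum>j=1..k. dct k i j * z j)\<^sup>2) = (\<Sum>j=1..k. (z j - 1 / k * (\<Sum>l=1..k. z l))\<^sup>2)"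
proof -
  define S where "S = (\<Sum>l=1..k. z l)"
  have "(\<Sum>i=1..k-1. (\<Sum>j=1..k. dct k i j * z j)\<^sup>2)
      = (\<Sum>i=1..k-1. \<Sum>j=1..k. \<Sum>j'=1..k. z j * z j' * (dct k i j * dct k i j'))"
    by (simp add: power2_eq_square sum_product mult_ac)
  also have "\<dots> = (\<Sum>j=1..k. \<Sum>i=1..k-1. \<Sum>j'=1..k. z j * z j' * (dct k i j * dct k i j'))"
    by (rule sum.swap)
  also have "\<dots> = (\<Sum>j=1..k. \<Sum>j'=1..k. z j * z j' * (\<Sum>i=1..k-1. dct k i j * dct k i j'))"
    unfolding sum_distrib_left by (intro sum.cong refl sum.swap)
  also have "\<dots> = (\<Sum>j=1..k. \<Sum>j'=1..k. z j * z j' * ((if j = j' then 1 else 0) - 1 / k))"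
    by (intro sum.cong refl) (simp only: dct_kernel)
  also have "\<dots> = (\<Sum>j=1..k. z j * z j - z j * S / k)"
  proof (intro sum.cong refl)
    fix j assume "j \<in> {1..k}"
    have "z j * z j' * ((if j = j' then 1 else 0) - 1 / k) = (if j = j' then z j * z j' else 0) - z j * z j' / k" for j'
      by (simp add: field_simps)
    then show "(\<Sum>j'=1..k. z j * z j' * ((if j = j' then 1 else 0) - 1 / k)) = z j * z j - z j * S / k"
      using \<open>j \<in> {1..k}\<close> by (simp add: sum_subtractf sum_distrib_left sum_divide_distrib S_def)
  qed
  also have "\<dots> = (\<Sum>j=1..k. (z j)\<^sup>2) - S\<^sup>2 / k"
    by (simp add: sum_subtractf power2_eq_square sum_distrib_right[symmetric] sum_divide_distrib[symmetric] S_def)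
  also have "\<dots> = (\<Sum>j=1..k. (z j - 1 / k * S)\<^sup>2)"
  proof -
    have "(\<Sum>j=1..k. (z j - 1 / k * S)\<^sup>2) = (\<Sum>j=1..k. (z j)\<^sup>2 - 2 * S / k * z j + S\<^sup>2 / k\<^sup>2)"
      by (intro sum.cong refl) (simp add: power2_diff power_divide mult_ac)
    also have "\<dots> = (\<Sum>j=1..k. (z j)\<^sup>2) - 2 * S / k * S + k * (S\<^sup>2 / k\<^sup>2)"
      by (simp add: sum.distrib sum_subtractf sum_distrib_left S_def)
    also have "\<dots> = (\<Sum>j=1..k. (z j)\<^sup>2) - S\<^sup>2 / k"
      using k by (simp add: power2_eq_square)
    finally show ?thesis by simp
  qed
  finally show ?thesis by (simp add: S_def)
qed

section \<open>Tail sums of the cosine vectors and the eigenvalues\<close>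

lemma sin_half_angle_pos:
  assumes "i \<in> {1..k-1}"
  shows "0 < sin (real i / real k * (pi / 2))"
proof (rule sin_gt_zero)
  show "real i / real k * (pi / 2) < pi"
  proof -
    have "real i / real k \<le> 1" using assms by auto
    then have "real i / real k * (pi / 2) \<le> 1 * (pi / 2)" by (intro mult_right_mono) auto
    then show ?thesis using pi_gt_zero by linarith
  qed
qed (use assms in auto)

text \<open>Up to the factor \<open>2 * sin (\<theta> / 2)\<close>, each entry is a difference of
  consecutive values of \<open>sin (j * \<theta>)\<close>. The sum telescopes, and the upper end is
  the sine of \<open>i * pi\<close>, which is 0. The lower end sits at \<open>l - 1\<close>, so the
  full sum from \<open>l = 1\<close> vanishes as well.\<close>

lemma dct_tail_sum:
  assumes i: "i \<in> {1..k-1}" and l: "l \<in> {1..k}"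
  shows "(\<Sum>j=l..k. dct k i j) =
    - sqrt (2 / k) * sin (real (l - 1) * (pi * i / k)) / (2 * sin (real i / real k * (pi / 2)))"
proof -
  define \<theta> where "\<theta> = pi * i / k"
  have k: "k \<ge> 1" using l by auto
  have \<theta>2: "real i / real k * (pi / 2) = \<theta> / 2" by (simp add: \<theta>_def)
  have s: "sin (\<theta> / 2) \<noteq> 0" using sin_half_angle_pos[OF i] unfolding \<theta>2 by simp
  have step: "dct k i j = sqrt (2 / k) / (2 * sin (\<theta> / 2)) * (sin (real j * \<theta>) - sin (real (j - 1) * \<theta>))"
    if "j \<ge> 1" for j
  proof -
    have "real j * \<theta> = (j - 1/2) * \<theta> + \<theta> / 2" "real (j - 1) * \<theta> = (j - 1/2) * \<theta> - \<theta> / 2"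
      using that by (simp_all add: field_simps of_nat_diff)
    then have "sin (real j * \<theta>) - sin (real (j - 1) * \<theta>) = 2 * sin (\<theta> / 2) * cos ((j - 1/2) * \<theta>)"
      by (simp only: sin_add sin_diff) simp
    moreover have "i * pi * (j - 1/2) / k = (j - 1/2) * \<theta>" by (simp add: \<theta>_def)
    ultimately show ?thesis using s by (simp add: dct_def)
  qed
  have "(\<Sum>j=l..k. sin (real j * \<theta>) - sin (real (j - 1) * \<theta>)) = sin (real k * \<theta>) - sin (real (l - 1) * \<theta>)"
    using sum_telescope''[of "l - 1" k "\<lambda>j. sin (real j * \<theta>)"] l by auto
  moreover have "sin (real k * \<theta>) = 0" using k by (simp add: \<theta>_def mult.commute)
  moreover have "(\<Sum>j=l..k. dct k i j) = sqrt (2 / k) / (2 * sin (\<theta> / 2)) *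
      (\<Sum>j=l..k. sin (real j * \<theta>) - sin (real (j - 1) * \<theta>))"
    unfolding sum_distrib_left using l by (intro sum.cong step refl) auto
  ultimately show ?thesis unfolding \<theta>2 by (simp add: \<theta>_def)
qed

text \<open>Zero weight sum is what makes the common centring \<open>a n\<close> drop out of the
  scores.\<close>

lemma sum_dct_eq_0: "i \<in> {1..k-1} \<Longrightarrow> (\<Sum>j=1..k. dct k i j) = 0"
  using dct_tail_sum[of i k 1] by auto

text \<open>The tails are multiples of sine vectors. In the product formula the frequencies
  \<open>i - i'\<close> and \<open>i + i'\<close> have equal parity, so distinct indices cancel; for
  equal indices the squared sine vector has length \<open>k / 2\<close>, and the normalisation
  leaves \<open>rw_eigenvalue k i\<close>.\<close>

lemma dct_tail_orthogonal:
  assumes i: "i \<in> {1..k-1}" and i': "i' \<in> {1..k-1}"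
  shows "(\<Sum>l=1..k. (\<Sum>j=l..k. dct k i j) * (\<Sum>j=l..k. dct k i' j)) = (if i = i' then rw_eigenvalue k i else 0)"
proof -
  have k: "k \<ge> 1" using i by auto
  define S where "S i = 2 * sin (real i / real k * (pi / 2))" for i :: nat
  have S: "S i \<noteq> 0" "S i' \<noteq> 0"
    using sin_half_angle_pos[OF i] sin_half_angle_pos[OF i'] by (auto simp: S_def)
  have ik: "i \<ge> 1" "i' \<ge> 1" "i < k" "i' < k" using i i' by auto
  have neg_prod: "(- q * a / u) * (- q * b / v) = q\<^sup>2 / (u * v) * (a * b)" for q a b u v :: real
    by (simp add: power2_eq_square)
  have "(\<Sum>l=1..k. (\<Sum>j=l..k. dct k i j) * (\<Sum>j=l..k. dct k i' j))
     = (\<Sum>l=1..k. 2 / (k * S i * S i') * (sin (real (l - 1) * (pi * i / k)) * sin (real (l - 1) * (pi * i' / k))))"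
  proof (intro sum.cong refl)
    fix l assume l: "l \<in> {1..k}"
    have "(\<Sum>j=l..k. dct k i j) * (\<Sum>j=l..k. dct k i' j) = (sqrt (2 / k))\<^sup>2 / (S i * S i') *
      (sin (real (l - 1) * (pi * i / k)) * sin (real (l - 1) * (pi * i' / k)))"
      unfolding dct_tail_sum[OF i l] dct_tail_sum[OF i' l]
      unfolding S_def[symmetric] by (rule neg_prod)
    then show "(\<Sum>j=l..k. dct k i j) * (\<Sum>j=l..k. dct k i' j) = 2 / (k * S i * S i') *
      (sin (real (l - 1) * (pi * i / k)) * sin (real (l - 1) * (pi * i' / k)))"
      by simp
  qed
  \<comment> \<open>Shifting \<open>l\<close> by one makes the sum start at 0, where the sine
    vanishes.\<close>
  also have "\<dots> = 2 / (k * S i * S i') * (\<Sum>l=1..k-1. sin (real l * (pi * i / k)) * sin (real l * (pi * i' / k)))"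
  proof -
    have "(\<Sum>l=1..k. sin (real (l - 1) * (pi * i / k)) * sin (real (l - 1) * (pi * i' / k)))
      = (\<Sum>l=0..k-1. sin (real l * (pi * i / k)) * sin (real l * (pi * i' / k)))"
      using sum.atLeast_Suc_atMost_Suc_shift[of "\<lambda>l. sin (real (l - 1) * (pi * i / k)) * sin (real (l - 1) * (pi * i' / k))" 0 "k - 1"] k
      by simp
    also have "\<dots> = (\<Sum>l=1..k-1. sin (real l * (pi * i / k)) * sin (real l * (pi * i' / k)))"
      by (simp add: sum.atLeast_Suc_atMost)
    finally show ?thesis by (simp only: sum_distrib_left[symmetric])
  qed
  also have "(\<Sum>l=1..k-1. sin (real l * (pi * i / k)) * sin (real l * (pi * i' / k)))
     = ((\<Sum>l=1..k-1. cos (real l * (pi * (int i - int i') / k))) - (\<Sum>l=1..k-1. cos (real l * (pi * (int i + int i') / k)))) / 2"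
    unfolding sum_subtractf[symmetric] sum_divide_distrib
  proof (intro sum.cong refl)
    fix l :: nat
    have "real l * (pi * i / k) - real l * (pi * i' / k) = real l * (pi * (int i - int i') / k)"
      "real l * (pi * i / k) + real l * (pi * i' / k) = real l * (pi * (int i + int i') / k)"
      by (simp_all add: field_simps diff_divide_distrib add_divide_distrib)
    then show "sin (real l * (pi * i / k)) * sin (real l * (pi * i' / k)) =
       (cos (real l * (pi * (int i - int i') / k)) - cos (real l * (pi * (int i + int i') / k))) / 2"
      by (simp only: sin_times_sin)
  qed
  also have "(\<Sum>l=1..k-1. cos (real l * (pi * (int i + int i') / k))) = (if even (int i + int i') then - 1 else 0)"
    using sum_cos_multiples[of "int i + int i'" k] ik by simp
  also have "(\<Sum>l=1..k-1. cos (real l * (pi * (int i - int i') / k))) =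
      (if i = i' then real k - 1 else if even (int i - int i') then - 1 else 0)"
    using sum_cos_multiples[of "int i - int i'" k] ik by (auto simp: of_nat_diff)
  finally show ?thesis
    using k S by (auto simp: rw_eigenvalue_def S_def power2_eq_square field_simps)
qed

text \<open>\<open>min i j\<close> counts the \<open>l\<close> that are at most both
  \<open>i\<close> and \<open>j\<close>: the random walk covariance is a triangular matrix of ones
  times its transpose.\<close>

lemma sum_min_eq_tail_squares:
  fixes w :: "nat \<Rightarrow> real"
  shows "(\<Sum>i=1..k. \<Sum>j=1..k. w i * w j * real (min i j)) = (\<Sum>l=1..k. (\<Sum>j=l..k. w j)\<^sup>2)"
proof -
  have ind: "(\<Sum>j=l..k. w j) = (\<Sum>j=1..k. if l \<le> j then w j else 0)" if "l \<in> {1..k}" for l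
  proof -
    have "{j \<in> {1..k}. l \<le> j} = {l..k}" using that by auto
    then show ?thesis by (simp add: sum.inter_filter[symmetric])
  qed
  have mn: "real (min i j) = (\<Sum>l=1..k. if l \<le> i \<and> l \<le> j then 1 else 0)" if "i \<in> {1..k}" for i j
  proof -
    have "{l \<in> {1..k}. l \<le> i \<and> l \<le> j} = {1..min i j}" using that by auto
    then show ?thesis by (simp add: sum.inter_filter[symmetric])
  qed
  have "(\<Sum>l=1..k. (\<Sum>j=l..k. w j)\<^sup>2) = (\<Sum>l=1..k. \<Sum>i=1..k. \<Sum>j=1..k. w i * w j * (if l \<le> i \<and> l \<le> j then 1 else 0))"
    by (intro sum.cong refl) (auto simp: ind power2_eq_square sum_product intro!: sum.cong)
  also have "\<dots> = (\<Sum>i=1..k. \<Sum>l=1..k. \<Sum>j=1..k. w i * w j * (if l \<le> i \<and> l \<le> j then 1 else 0))"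
    by (rule sum.swap)
  also have "\<dots> = (\<Sum>i=1..k. \<Sum>j=1..k. \<Sum>l=1..k. w i * w j * (if l \<le> i \<and> l \<le> j then 1 else 0))"
    by (intro sum.cong refl sum.swap)
  also have "\<dots> = (\<Sum>i=1..k. \<Sum>j=1..k. w i * w j * real (min i j))"
    by (intro sum.cong refl) (simp only: mn sum_distrib_left)
  finally show ?thesis by simp
qed

text \<open>Pythagoras: forming tails is linear, and the tails of distinct cosine vectors are
  orthogonal. Together with \<open>sum_min_eq_tail_squares\<close> this diagonalises the covariance
  \<open>min i j\<close> on vectors of mean zero.\<close>

lemma dct_combination_tail_squares:
  "(\<Sum>l=1..k. (\<Sum>j=l..k. \<Sum>i=1..k-1. b i * dct k i j)\<^sup>2) = (\<Sum>i=1..k-1. (b i)\<^sup>2 * rw_eigenvalue k i)"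
proof -
  define D where "D i l = (\<Sum>j=l..k. dct k i j)" for i l
  have "(\<Sum>j=l..k. \<Sum>i=1..k-1. b i * dct k i j) = (\<Sum>i=1..k-1. b i * D i l)" for l
    by (subst sum.swap) (simp add: D_def sum_distrib_left)
  then have "(\<Sum>l=1..k. (\<Sum>j=l..k. \<Sum>i=1..k-1. b i * dct k i j)\<^sup>2) =
     (\<Sum>l=1..k. \<Sum>i=1..k-1. \<Sum>i'=1..k-1. b i * b i' * (D i l * D i' l))"
    by (simp add: power2_eq_square sum_product mult_ac)
  also have "\<dots> = (\<Sum>i=1..k-1. \<Sum>i'=1..k-1. b i * b i' * (\<Sum>l=1..k. D i l * D i' l))"
    unfolding sum_distrib_left by (rule trans[OF sum.swap], rule sum.cong[OF refl], rule sum.swap)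
  also have "\<dots> = (\<Sum>i=1..k-1. \<Sum>i'=1..k-1. b i * b i' * (if i = i' then rw_eigenvalue k i else 0))"
    unfolding D_def by (intro sum.cong refl) (simp only: dct_tail_orthogonal)
  also have "\<dots> = (\<Sum>i=1..k-1. (b i)\<^sup>2 * rw_eigenvalue k i)"
    by (simp add: if_distrib power2_eq_square cong: if_cong)
  finally show ?thesis .
qed

subsection \<open>Characteristic functions\<close>

text \<open>Independence factors the characteristic function at 1. Read from right to left, the
  identity linearises a Gaussian function of the coefficients \<open>b i\<close>, whose role is
  later played by the scores.\<close>

lemma (in prob_space) expectation_iexp_normal_combination:
  fixes \<xi> :: "'i \<Rightarrow> 'a \<Rightarrow> real"
  assumes indep: "indep_vars (\<lambda>_. borel) \<xi> I"
    and normal: "\<And>i. i \<in> I \<Longrightarrow> distributed M lborel (\<xi> i) std_normal_density"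
  shows "(CLINT x|M. iexp (\<Sum>i\<in>I. b i * \<xi> i x)) = exp (- (\<Sum>i\<in>I. (b i)\<^sup>2) / 2)"
proof (cases "finite I")
  case True
  have rv: "\<xi> i \<in> borel_measurable M" if "i \<in> I" for i
    using indep that by (auto simp: indep_vars_def)
  have "(CLINT x|M. iexp (\<Sum>i\<in>I. b i * \<xi> i x)) = char (distr M borel (\<lambda>x. \<Sum>i\<in>I. b i * \<xi> i x)) 1"
    using rv by (simp add: char_def integral_distr)
  also have "\<dots> = (\<Prod>i\<in>I. char (distr M borel (\<lambda>x. b i * \<xi> i x)) 1)"
    by (intro char_distr_sum indep_vars_compose2[OF indep]) auto
  also have "\<dots> = (\<Prod>i\<in>I. complex_of_real (exp (- ((b i)\<^sup>2) / 2)))"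
  proof (intro prod.cong refl)
    fix i assume i: "i \<in> I"
    have "char (distr M borel (\<lambda>x. b i * \<xi> i x)) 1 = char (distr M lborel (\<xi> i)) (b i)"
      using rv[OF i] by (simp add: char_def integral_distr)
    also have "distr M lborel (\<xi> i) = std_normal_distribution"
      using normal[OF i] by (simp add: distributed_def)
    finally show "char (distr M borel (\<lambda>x. b i * \<xi> i x)) 1 = complex_of_real (exp (- ((b i)\<^sup>2) / 2))"
      by (simp add: char_std_normal_distribution)
  qed
  also have "\<dots> = exp (- (\<Sum>i\<in>I. (b i)\<^sup>2) / 2)"
    using True by (simp add: exp_sum sum_negf[symmetric] sum_divide_distrib flip: of_real_prod)
  finally show ?thesis .
\<comment> \<open>For infinite \<open>I\<close> both sums are 0 by convention, and both sides equal
  1.\<close>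
qed (simp add: prob_space)

text \<open>A central limit theorem for triangular arrays. Each factor of the characteristic
  function is compared with \<open>w n = 1 - \<sigma>2 / (2 * n)\<close>, whose \<open>n\<close>-th
  power has the stated limit. The vanishing bound \<open>b n\<close> acts as a Lindeberg condition,
  since the third absolute moment is at most \<open>b n * v n\<close>.\<close>

lemma (in prob_space) bounded_array_iexp_limit:
  fixes X :: "nat \<Rightarrow> nat \<Rightarrow> 'a \<Rightarrow> real"
  assumes indep: "\<And>n. indep_vars (\<lambda>_. borel) (X n) {1..n}"
    and bound: "\<And>n i \<omega>. i \<in> {1..n} \<Longrightarrow> \<bar>X n i \<omega>\<bar> \<le> b n"
    and mean: "\<And>n i. i \<in> {1..n} \<Longrightarrow> expectation (X n i) = \<mu> n"
    and second: "\<And>n i. i \<in> {1..n} \<Longrightarrow> expectation (\<lambda>\<omega>. (X n i \<omega>)\<^sup>2) = v n"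
    and b: "b \<longlonglongrightarrow> 0"
    and \<mu>: "(\<lambda>n. real n * \<mu> n) \<longlonglongrightarrow> 0"
    and v: "(\<lambda>n. real n * v n) \<longlonglongrightarrow> \<sigma>2"
  shows "(\<lambda>n. CLINT \<omega>|M. iexp (\<Sum>i=1..n. X n i \<omega>)) \<longlonglongrightarrow> exp (- \<sigma>2 / 2)"
proof -
  define \<phi> where "\<phi> n i = (CLINT \<omega>|M. iexp (X n i \<omega>))" for n i
  define w where "w n = complex_of_real (1 + (- \<sigma>2 / 2) / real n)" for n :: nat
  \<comment> \<open>The three terms are \<open>n\<close> times the errors from the mean, from the
    second moment and from the Taylor remainder of one factor; the factor \<open>n\<close> accounts
    for the \<open>n\<close> factors of the product.\<close>
  define err where "err n = \<bar>real n * \<mu> n\<bar> + \<bar>real n * v n - \<sigma>2\<bar> / 2 + b n * (real n * v n) / 6" for n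
  have rv [measurable]: "X n i \<in> borel_measurable M" if "i \<in> {1..n}" for n i
    using indep[of n] that by (auto simp: indep_vars_def)
  have v0: "0 \<le> v n" if "n \<ge> 1" for n
    using second[of 1 n] that by (metis atLeastAtMost_iff integral_nonneg_AE le_refl AE_I2 zero_le_power2)
  have "\<sigma>2 \<ge> 0"
    by (rule tendsto_lowerbound[OF v]) (auto intro!: eventually_sequentiallyI[of 1] mult_nonneg_nonneg v0)
  have taylor: "(\<Sum>k\<le>2. (\<i> * complex_of_real x) ^ k / fact k) = 1 + \<i> * x - x\<^sup>2 / 2" for x
    by (simp add: eval_nat_numeral algebra_simps)
  have approx: "real n * norm (\<phi> n i - w n) \<le> err n" if i: "i \<in> {1..n}" for n i
  proof -
    note rv[OF i, measurable]
    have n: "n \<ge> 1" using i by auto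
    have intX: "integrable M (X n i)"
      by (rule integrable_const_bound[where B="b n"]) (use bound[OF i] in auto)
    have intX2: "integrable M (\<lambda>\<omega>. (X n i \<omega>)\<^sup>2)"
    proof (rule integrable_const_bound[where B="(b n)\<^sup>2"])
      have "(X n i \<omega>)\<^sup>2 \<le> (b n)\<^sup>2" for \<omega>
        using power_mono[OF bound[OF i, of \<omega>] abs_ge_zero, of 2] by simp
      then show "AE \<omega> in M. norm ((X n i \<omega>)\<^sup>2) \<le> (b n)\<^sup>2" by simp
    qed simp
    have intE: "integrable M (\<lambda>\<omega>. iexp (X n i \<omega>))" by (rule integrable_iexp) simp_all
    have "(CLINT \<omega>|M. 1 + \<i> * X n i \<omega> - (X n i \<omega>)\<^sup>2 / 2) = 1 + \<i> * \<mu> n - v n / 2"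
      using intX intX2 mean[OF i] second[OF i] by (simp add: prob_space flip: of_real_power)
    then have "\<phi> n i - (1 + \<i> * \<mu> n - v n / 2) = (CLINT \<omega>|M. iexp (X n i \<omega>) - (1 + \<i> * X n i \<omega> - (X n i \<omega>)\<^sup>2 / 2))"
      unfolding \<phi>_def using intX intX2 intE
      by (subst Bochner_Integration.integral_diff) (auto simp flip: of_real_power)
    also have "norm \<dots> \<le> (\<integral>\<omega>. norm (iexp (X n i \<omega>) - (1 + \<i> * X n i \<omega> - (X n i \<omega>)\<^sup>2 / 2)) \<partial>M)"
      by (rule integral_norm_bound)
    also have "\<dots> \<le> (\<integral>\<omega>. b n * (X n i \<omega>)\<^sup>2 / 6 \<partial>M)"
    proof (rule integral_mono)
      fix \<omega> assume "\<omega> \<in> space M"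
      have "norm (iexp (X n i \<omega>) - (1 + \<i> * X n i \<omega> - (X n i \<omega>)\<^sup>2 / 2)) \<le> \<bar>X n i \<omega>\<bar> ^ 3 / 6"
        using iexp_approx1[of "X n i \<omega>" 2] by (simp add: taylor fact_numeral)
      also have "\<bar>X n i \<omega>\<bar> ^ 3 = \<bar>X n i \<omega>\<bar> * (X n i \<omega>)\<^sup>2"
        by (simp add: power3_eq_cube power2_eq_square mult.assoc)
      also have "\<dots> \<le> b n * (X n i \<omega>)\<^sup>2"
        by (intro mult_right_mono bound i) simp
      finally show "norm (iexp (X n i \<omega>) - (1 + \<i> * X n i \<omega> - (X n i \<omega>)\<^sup>2 / 2)) \<le> b n * (X n i \<omega>)\<^sup>2 / 6"
        by simp
    qed (use intX intX2 intE in \<open>auto simp flip: of_real_power\<close>)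
    also have "\<dots> = b n * v n / 6" by (simp add: second[OF i])
    finally have 1: "norm (\<phi> n i - (1 + \<i> * \<mu> n - v n / 2)) \<le> b n * v n / 6" .
    have dist: "x * (y * z / 6 + m + d / 2) = x * m + x * d / 2 + y * (x * z) / 6" for x y z m d :: real
      by (simp add: algebra_simps)
    have "\<phi> n i - w n = (\<phi> n i - (1 + \<i> * \<mu> n - v n / 2)) + \<i> * \<mu> n - complex_of_real ((v n - \<sigma>2 / n) / 2)"
      by (simp add: w_def diff_divide_distrib)
    also have "norm \<dots> \<le> norm (\<phi> n i - (1 + \<i> * \<mu> n - v n / 2)) + norm (\<i> * \<mu> n) + norm (complex_of_real ((v n - \<sigma>2 / n) / 2))"
      by (rule order_trans[OF norm_triangle_ineq4 add_right_mono[OF norm_triangle_ineq]])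
    also have "\<dots> \<le> b n * v n / 6 + \<bar>\<mu> n\<bar> + \<bar>v n - \<sigma>2 / n\<bar> / 2"
      using 1 by (simp add: norm_mult del: of_real_divide of_real_diff)
    finally have "real n * norm (\<phi> n i - w n) \<le> real n * (b n * v n / 6 + \<bar>\<mu> n\<bar> + \<bar>v n - \<sigma>2 / n\<bar> / 2)"
      by (rule mult_left_mono) simp
    also have "\<dots> = \<bar>real n * \<mu> n\<bar> + \<bar>real n * (v n - \<sigma>2 / n)\<bar> / 2 + b n * (real n * v n) / 6"
      unfolding abs_mult abs_of_nat by (rule dist)
    also have "real n * (v n - \<sigma>2 / n) = real n * v n - \<sigma>2" using n by (simp add: field_simps)
    finally show ?thesis by (simp add: err_def)
  qed
  have \<phi>1: "norm (\<phi> n i) \<le> 1" if i: "i \<in> {1..n}" for n i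
  proof -
    have "norm (\<phi> n i) \<le> (\<integral>\<omega>. norm (iexp (X n i \<omega>)) \<partial>M)"
      unfolding \<phi>_def by (rule integral_norm_bound)
    then show ?thesis by (simp add: prob_space)
  qed
  have prod: "(CLINT \<omega>|M. iexp (\<Sum>i=1..n. X n i \<omega>)) = (\<Prod>i=1..n. \<phi> n i)" for n
    using char_distr_sum[OF indep[of n], of 1] by (simp add: char_def integral_distr \<phi>_def)
  have ev: "eventually (\<lambda>n. norm ((CLINT \<omega>|M. iexp (\<Sum>i=1..n. X n i \<omega>)) - w n ^ n) \<le> err n) sequentially"
  proof (rule eventually_sequentiallyI)
    \<comment> \<open>From \<open>\<sigma>2 / 4\<close> on, \<open>w n\<close> is at least -1, hence
      of modulus at most 1, as the comparison of products requires.\<close>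
    fix n assume "n \<ge> max 1 (nat \<lceil>\<sigma>2 / 4\<rceil>)"
    then have n: "n \<ge> 1" "real n \<ge> \<sigma>2 / 4" by linarith+
    have w1: "norm (w n) \<le> 1"
      using n \<open>\<sigma>2 \<ge> 0\<close> unfolding w_def norm_of_real by (intro abs_leI) (auto simp: field_simps)
    have "norm ((\<Prod>i=1..n. \<phi> n i) - (\<Prod>i=1..n. w n)) \<le> (\<Sum>i=1..n. norm (\<phi> n i - w n))"
      by (intro norm_prod_diff \<phi>1 w1)
    also have "\<dots> \<le> (\<Sum>i=1..n. err n / n)"
      using n approx by (intro sum_mono) (simp add: field_simps)
    also have "\<dots> = err n" using n by simp
    finally show "norm ((CLINT \<omega>|M. iexp (\<Sum>i=1..n. X n i \<omega>)) - w n ^ n) \<le> err n"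
      unfolding prod by simp
  qed
  have "err \<longlonglongrightarrow> \<bar>0\<bar> + \<bar>\<sigma>2 - \<sigma>2\<bar> / 2 + 0 * \<sigma>2 / 6"
    unfolding err_def by (intro tendsto_intros \<mu> v b) simp_all
  then have "err \<longlonglongrightarrow> 0" by simp
  with ev have "(\<lambda>n. (CLINT \<omega>|M. iexp (\<Sum>i=1..n. X n i \<omega>)) - w n ^ n) \<longlonglongrightarrow> 0"
    by (rule Lim_null_comparison)
  moreover have "(\<lambda>n. w n ^ n) \<longlonglongrightarrow> exp (- \<sigma>2 / 2)"
    unfolding w_def of_real_power[symmetric]
    by (intro tendsto_of_real tendsto_exp_limit_sequentially)
  ultimately show ?thesis
    by (rule Lim_transform[rotated])
qed

text \<open>The variance of the absolute value of \<open>X\<close> is nonnegative.\<close>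

lemma (in prob_space) expectation_abs_le_sqrt:
  fixes X :: "'a \<Rightarrow> real"
  assumes [measurable]: "X \<in> borel_measurable M" and "integrable M (\<lambda>\<omega>. (X \<omega>)\<^sup>2)"
  shows "expectation (\<lambda>\<omega>. \<bar>X \<omega>\<bar>) \<le> sqrt (expectation (\<lambda>\<omega>. (X \<omega>)\<^sup>2))"
proof -
  have "integrable M (\<lambda>\<omega>. \<bar>X \<omega>\<bar>)"
    using square_integrable_imp_integrable[OF assms] by simp
  then have "(expectation (\<lambda>\<omega>. \<bar>X \<omega>\<bar>))\<^sup>2 \<le> expectation (\<lambda>\<omega>. (X \<omega>)\<^sup>2)"
    using variance_eq[of "\<lambda>\<omega>. \<bar>X \<omega>\<bar>"] variance_positive[of "\<lambda>\<omega>. \<bar>X \<omega>\<bar>"] assms by simp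
  then show ?thesis by (rule real_le_rsqrt)
qed

subsection \<open>Counts of nested events\<close>

text \<open>The features of the exceedance events on which the limit law rests: independent
  observations, events decreasing in \<open>j\<close>, and probabilities \<open>p n j\<close> close
  to \<open>a n / (n * j)\<close>, with a bias small on the scale \<open>sqrt (a n)\<close> of the
  fluctuations. The index \<open>n = 0\<close> is excluded because thresholds are controlled only
  from 1 on.\<close>

locale nested_indicators = prob_space M for M :: "'a measure" +
  fixes S :: "'b measure" and Y :: "nat \<Rightarrow> 'a \<Rightarrow> 'b" and h :: "nat \<Rightarrow> nat \<Rightarrow> 'b \<Rightarrow> real"
    and p :: "nat \<Rightarrow> nat \<Rightarrow> real" and a :: "nat \<Rightarrow> real" and k :: nat
  assumes indep: "indep_vars (\<lambda>_. S) Y {1..}"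
    and h_measurable [measurable]: "\<And>n j. h n j \<in> borel_measurable S"
    and h_01: "\<And>n j y. h n j y \<in> {0, 1}"
    and h_nested: "\<And>n i j y. \<lbrakk>n \<ge> 1; i \<in> {1..k}; j \<in> {1..k}\<rbrakk> \<Longrightarrow> h n i y * h n j y = h n (max i j) y"
    and expectation_h: "\<And>n i j. \<lbrakk>n \<ge> 1; i \<ge> 1; j \<in> {1..k}\<rbrakk> \<Longrightarrow> expectation (\<lambda>\<omega>. h n j (Y i \<omega>)) = p n j"
    and a_pos: "\<And>n. n \<ge> 1 \<Longrightarrow> 0 < a n"
    and a_top: "filterlim a at_top sequentially"
    and bias: "\<And>j. j \<in> {1..k} \<Longrightarrow> (\<lambda>n. (real n * (real j * p n j) - a n) / sqrt (a n)) \<longlonglongrightarrow> 0"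
    and k: "k \<ge> 1"
begin

definition count :: "nat \<Rightarrow> nat \<Rightarrow> 'a \<Rightarrow> real" where
  "count n j \<omega> = (\<Sum>i=1..n. h n j (Y i \<omega>))"

definition mean_count :: "nat \<Rightarrow> 'a \<Rightarrow> real" where
  "mean_count n \<omega> = 1 / real k * (\<Sum>l=1..k. real l * count n l \<omega>)"

definition statistic :: "nat \<Rightarrow> 'a \<Rightarrow> real" where
  "statistic n \<omega> = (\<Sum>j=1..k. (real j * count n j \<omega> - mean_count n \<omega>)\<^sup>2) / mean_count n \<omega>"

text \<open>No mean is subtracted: the scores are used with weights of sum zero, for which the
  leading mean cancels by itself.\<close>

definition score :: "nat \<Rightarrow> (nat \<Rightarrow> real) \<Rightarrow> 'a \<Rightarrow> real" where
  "score n w \<omega> = (\<Sum>j=1..k. w j * (real j * count n j \<omega>)) / sqrt (a n)"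

lemma Y_measurable: "i \<ge> 1 \<Longrightarrow> Y i \<in> measurable M S"
  using indep by (auto simp: indep_vars_def)

lemma h_Y_measurable: "i \<ge> 1 \<Longrightarrow> (\<lambda>\<omega>. h n j (Y i \<omega>)) \<in> borel_measurable M"
  by (rule measurable_compose[OF Y_measurable h_measurable])

lemma count_measurable [measurable]: "count n j \<in> borel_measurable M"
  unfolding count_def[abs_def] by (intro borel_measurable_sum h_Y_measurable) simp

lemma mean_count_measurable [measurable]: "mean_count n \<in> borel_measurable M"
  unfolding mean_count_def[abs_def] by measurable

lemma statistic_measurable [measurable]: "statistic n \<in> borel_measurable M"
  unfolding statistic_def[abs_def] by measurable

lemma score_measurable [measurable]: "score n w \<in> borel_measurable M"
  unfolding score_def[abs_def] by measurable

lemma h_nonneg: "0 \<le> h n j y" and h_le_1: "h n j y \<le> 1"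
  using h_01[of n j y] by auto

lemma count_nonneg: "0 \<le> count n j \<omega>"
  unfolding count_def by (intro sum_nonneg h_nonneg)

lemma mean_count_nonneg: "0 \<le> mean_count n \<omega>"
  unfolding mean_count_def by (intro mult_nonneg_nonneg sum_nonneg count_nonneg) auto

lemma statistic_nonneg: "0 \<le> statistic n \<omega>"
  unfolding statistic_def by (intro divide_nonneg_nonneg sum_nonneg mean_count_nonneg) auto

lemma h_Y_integrable: "i \<ge> 1 \<Longrightarrow> integrable M (\<lambda>\<omega>. h n j (Y i \<omega>))"
  by (intro integrable_const_bound[where B=1] h_Y_measurable) (auto simp: h_nonneg h_le_1)

lemma eventually_a_pos: "eventually (\<lambda>n. 0 < a n) sequentially"
  by (rule eventually_sequentiallyI[of 1]) (rule a_pos)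

lemma inverse_sqrt_a: "(\<lambda>n. 1 / sqrt (a n)) \<longlonglongrightarrow> 0"
  by (intro tendsto_divide_0[OF tendsto_const] filterlim_at_top_imp_at_infinity
      filterlim_compose[OF sqrt_at_top a_top])

section \<open>Gaussian limit of the linear scores\<close>

lemma expected_ratio:
  assumes j: "j \<in> {1..k}"
  shows "(\<lambda>n. real n * p n j / a n) \<longlonglongrightarrow> 1 / real j"
proof -
  have "(\<lambda>n. (1 + (real n * (real j * p n j) - a n) / sqrt (a n) * (1 / sqrt (a n))) / real j) \<longlonglongrightarrow> (1 + 0 * 0) / real j"
    using j by (intro tendsto_intros bias[OF j] inverse_sqrt_a) auto
  moreover have "eventually (\<lambda>n. (1 + (real n * (real j * p n j) - a n) / sqrt (a n) * (1 / sqrt (a n))) / real j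
      = real n * p n j / a n) sequentially"
    using eventually_a_pos by eventually_elim (use j in \<open>simp add: field_simps\<close>)
  ultimately show ?thesis by (simp add: tendsto_cong)
qed

text \<open>The score is a row sum of independent variables of size at most a constant over
  \<open>sqrt (a n)\<close>. Nesting reduces products of indicators to the one of index
  \<open>max i j\<close>, so the limit covariance of the weighted counts is
  \<open>i * j / max i j\<close>, that is \<open>min i j\<close>.\<close>

lemma score_iexp_limit:
  assumes w: "(\<Sum>j=1..k. w j) = 0"
  shows "(\<lambda>n. CLINT \<omega>|M. iexp (score n w \<omega>)) \<longlonglongrightarrow> exp (- (\<Sum>l=1..k. (\<Sum>j=l..k. w j)\<^sup>2) / 2)"
proof -
  define X where "X n i \<omega> = (\<Sum>j=1..k. w j * real j * h n j (Y i \<omega>)) / sqrt (a n)" for n i \<omega>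
  define \<mu> where "\<mu> n = (\<Sum>j=1..k. w j * real j * p n j) / sqrt (a n)" for n
  define v where "v n = (\<Sum>i=1..k. \<Sum>j=1..k. w i * w j * (real i * real j) * p n (max i j)) / a n" for n
  define B where "B = (\<Sum>j=1..k. \<bar>w j\<bar> * real j)"
  have score: "score n w \<omega> = (\<Sum>i=1..n. X n i \<omega>)" for n \<omega>
  proof -
    have "(\<Sum>j=1..k. w j * (real j * count n j \<omega>)) = (\<Sum>j=1..k. \<Sum>i=1..n. w j * real j * h n j (Y i \<omega>))"
      by (simp add: count_def sum_distrib_left mult.assoc)
    also have "\<dots> = (\<Sum>i=1..n. \<Sum>j=1..k. w j * real j * h n j (Y i \<omega>))" by (rule sum.swap)
    finally show ?thesis by (simp add: score_def X_def sum_divide_distrib)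
  qed
  have "(\<lambda>n. CLINT \<omega>|M. iexp (\<Sum>i=1..n. X n i \<omega>)) \<longlonglongrightarrow>
      exp (- (\<Sum>i=1..k. \<Sum>j=1..k. w i * w j * real (min i j)) / 2)"
  proof (rule bounded_array_iexp_limit)
    show "indep_vars (\<lambda>_. borel) (X n) {1..n}" for n
      unfolding X_def
      by (rule indep_vars_compose2[where Y="\<lambda>i y. (\<Sum>j=1..k. w j * real j * h n j y) / sqrt (a n)",
            OF indep_vars_subset[OF indep]]) auto
    show "\<bar>X n i \<omega>\<bar> \<le> B * (1 / sqrt (a n))" if "i \<in> {1..n}" for n i \<omega>
    proof -
      have "0 < a n" using a_pos that by simp
      have "\<bar>\<Sum>j=1..k. w j * real j * h n j (Y i \<omega>)\<bar> \<le> (\<Sum>j=1..k. \<bar>w j * real j * h n j (Y i \<omega>)\<bar>)"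
        by (rule sum_abs)
      also have "\<dots> \<le> B"
        unfolding B_def by (intro sum_mono) (auto simp: abs_mult h_nonneg h_le_1 intro!: mult_left_le)
      finally show ?thesis using \<open>0 < a n\<close> by (simp add: X_def abs_divide divide_right_mono)
    qed
    show "expectation (X n i) = \<mu> n" if i: "i \<in> {1..n}" for n i
      using i unfolding X_def[abs_def] \<mu>_def
      by (simp add: h_Y_integrable expectation_h Bochner_Integration.integral_sum)
    show "expectation (\<lambda>\<omega>. (X n i \<omega>)\<^sup>2) = v n" if i: "i \<in> {1..n}" for n i
    proof -
      have "0 < a n" using a_pos i by simp
      have "(X n i \<omega>)\<^sup>2 = (\<Sum>i'=1..k. \<Sum>j=1..k. w i' * w j * (real i' * real j) * h n (max i' j) (Y i \<omega>)) / a n" for \<omega>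
      proof -
        have "(X n i \<omega>)\<^sup>2 = (\<Sum>i'=1..k. \<Sum>j=1..k. w i' * w j * (real i' * real j) * (h n i' (Y i \<omega>) * h n j (Y i \<omega>))) / a n"
          using \<open>0 < a n\<close> by (simp add: X_def power_divide power2_eq_square sum_product mult_ac)
        then show ?thesis using i by (simp add: h_nested)
      qed
      moreover have "expectation (\<lambda>\<omega>. h n (max i' j) (Y i \<omega>)) = p n (max i' j)"
        if "i' \<in> {1..k}" "j \<in> {1..k}" for i' j
        using that i by (intro expectation_h) (auto simp: max_def)
      ultimately show ?thesis
        using i by (simp add: v_def h_Y_integrable Bochner_Integration.integral_sum)
    qed
    show "(\<lambda>n. B * (1 / sqrt (a n))) \<longlonglongrightarrow> 0"
      using tendsto_mult[OF tendsto_const inverse_sqrt_a, of B] by simp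
    \<comment> \<open>Since the weights sum to zero, \<open>a n\<close> may be subtracted in every
      summand, which exhibits the bias.\<close>
    have "real n * \<mu> n = (\<Sum>j=1..k. w j * ((real n * (real j * p n j) - a n) / sqrt (a n)))" for n
    proof -
      have "(\<Sum>j=1..k. w j * ((real n * (real j * p n j) - a n) / sqrt (a n)))
         = (\<Sum>j=1..k. real n * (w j * real j * p n j) - w j * a n) / sqrt (a n)"
        unfolding sum_divide_distrib by (intro sum.cong refl) (simp add: algebra_simps)
      also have "\<dots> = ((\<Sum>j=1..k. real n * (w j * real j * p n j)) - (\<Sum>j=1..k. w j) * a n) / sqrt (a n)"
        by (simp add: sum_subtractf sum_distrib_right)
      finally show ?thesis unfolding w by (simp add: \<mu>_def sum_distrib_left)
    qed
    moreover have "(\<lambda>n. \<Sum>j=1..k. w j * ((real n * (real j * p n j) - a n) / sqrt (a n))) \<longlonglongrightarrow> (\<Sum>j=1..k. w j * 0)"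
      by (intro tendsto_intros bias)
    ultimately show "(\<lambda>n. real n * \<mu> n) \<longlonglongrightarrow> 0" by simp
    have "real n * v n = (\<Sum>i=1..k. \<Sum>j=1..k. w i * w j * (real i * real j) * (real n * p n (max i j) / a n))" for n
      by (simp add: v_def sum_distrib_left sum_divide_distrib mult_ac)
    moreover have "(\<lambda>n. \<Sum>i=1..k. \<Sum>j=1..k. w i * w j * (real i * real j) * (real n * p n (max i j) / a n)) \<longlonglongrightarrow>
        (\<Sum>i=1..k. \<Sum>j=1..k. w i * w j * (real i * real j) * (1 / real (max i j)))"
      by (intro tendsto_intros expected_ratio) auto
    moreover have "(\<Sum>i=1..k. \<Sum>j=1..k. w i * w j * (real i * real j) * (1 / real (max i j)))
       = (\<Sum>i=1..k. \<Sum>j=1..k. w i * w j * real (min i j))"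
      by (intro sum.cong refl) (auto simp: max_def min_def)
    ultimately show "(\<lambda>n. real n * v n) \<longlonglongrightarrow> (\<Sum>i=1..k. \<Sum>j=1..k. w i * w j * real (min i j))"
      by simp
  qed
  then show ?thesis by (simp only: score sum_min_eq_tail_squares)
qed

section \<open>Second moments of the counts and convergence of the denominator\<close>

lemma expectation_count_square:
  assumes n: "n \<ge> 1" and j: "j \<in> {1..k}"
  shows "expectation (\<lambda>\<omega>. (count n j \<omega>)\<^sup>2) = real n * p n j + real n * (real n - 1) * (p n j)\<^sup>2"
proof -
  define H where "H i \<omega> = h n j (Y i \<omega>)" for i \<omega>
  \<comment> \<open>The diagonal uses idempotence of indicators, the rest independence. Splitting
    off the square of \<open>p n j\<close> everywhere leaves a correction on the diagonal
    only.\<close>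
  have E: "expectation (\<lambda>\<omega>. H i \<omega> * H i' \<omega>) = (if i = i' then p n j - (p n j)\<^sup>2 else 0) + (p n j)\<^sup>2"
    if "i \<in> {1..n}" "i' \<in> {1..n}" for i i'
  proof (cases "i = i'")
    case True
    have "H i \<omega> * H i \<omega> = H i \<omega>" for \<omega> using h_01[of n j "Y i \<omega>"] by (auto simp: H_def)
    then have "expectation (\<lambda>\<omega>. H i \<omega> * H i \<omega>) = expectation (\<lambda>\<omega>. h n j (Y i \<omega>))"
      by (intro Bochner_Integration.integral_cong) (simp_all add: H_def)
    then show ?thesis using True that n j expectation_h[of n i j] by simp
  next
    case False
    have ind: "indep_vars (\<lambda>_. borel) H {i, i'}"
      unfolding H_def
      by (rule indep_vars_compose2[where Y="\<lambda>i. h n j", OF indep_vars_subset[OF indep]]) (use that in auto)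
    have "integrable M (H l)" if "l \<ge> 1" for l
      unfolding H_def using that by (rule h_Y_integrable)
    with ind that have "expectation (\<lambda>\<omega>. \<Prod>l\<in>{i, i'}. H l \<omega>) = (\<Prod>l\<in>{i, i'}. expectation (H l))"
      by (intro indep_vars_lebesgue_integral) auto
    moreover have "expectation (H l) = p n j" if "l \<in> {1..n}" for l
      using expectation_h[of n l j] that n j by (simp add: H_def[abs_def])
    ultimately show ?thesis using False that by (simp add: power2_eq_square)
  qed
  have int: "integrable M (\<lambda>\<omega>. H i \<omega> * H i' \<omega>)" if "i \<in> {1..n}" "i' \<in> {1..n}" for i i'
    using that unfolding H_def
    by (intro integrable_const_bound[where B=1] borel_measurable_times h_Y_measurable)
      (auto simp: abs_mult h_nonneg h_le_1 mult_le_one)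
  have "expectation (\<lambda>\<omega>. (count n j \<omega>)\<^sup>2) = expectation (\<lambda>\<omega>. \<Sum>i=1..n. \<Sum>i'=1..n. H i \<omega> * H i' \<omega>)"
    by (simp add: count_def H_def power2_eq_square sum_product)
  also have "\<dots> = (\<Sum>i=1..n. \<Sum>i'=1..n. (if i = i' then p n j - (p n j)\<^sup>2 else 0) + (p n j)\<^sup>2)"
  proof -
    have "expectation (\<lambda>\<omega>. \<Sum>i=1..n. \<Sum>i'=1..n. H i \<omega> * H i' \<omega>) =
        (\<Sum>i=1..n. expectation (\<lambda>\<omega>. \<Sum>i'=1..n. H i \<omega> * H i' \<omega>))"
      by (intro Bochner_Integration.integral_sum Bochner_Integration.integrable_sum int)
    also have "\<dots> = (\<Sum>i=1..n. \<Sum>i'=1..n. expectation (\<lambda>\<omega>. H i \<omega> * H i' \<omega>))"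
      by (intro sum.cong refl Bochner_Integration.integral_sum int)
    also have "\<dots> = (\<Sum>i=1..n. \<Sum>i'=1..n. (if i = i' then p n j - (p n j)\<^sup>2 else 0) + (p n j)\<^sup>2)"
      by (intro sum.cong refl E)
    finally show ?thesis .
  qed
  also have "\<dots> = real n * p n j + real n * (real n - 1) * (p n j)\<^sup>2"
    by (simp add: sum.distrib algebra_simps)
  finally show ?thesis .
qed

lemma count_le: "count n j \<omega> \<le> n"
  using sum_mono[of "{1..n}" "\<lambda>i. h n j (Y i \<omega>)" "\<lambda>_. 1"] by (simp add: count_def h_le_1)

lemma count_integrable: "integrable M (count n j)"
  by (rule integrable_const_bound[where B=n]) (auto simp: count_nonneg count_le)

lemma count_square_integrable: "integrable M (\<lambda>\<omega>. (count n j \<omega>)\<^sup>2)"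
  by (rule integrable_const_bound[where B="(real n)\<^sup>2"]) (auto intro!: power_mono simp: count_nonneg count_le)

text \<open>The mean square is at most a variance term of order \<open>1 / a n\<close> plus the
  squared bias of the mean, and both vanish by \<open>expected_ratio\<close>.\<close>

lemma scaled_count_L1:
  assumes j: "j \<in> {1..k}"
  shows "(\<lambda>n. expectation (\<lambda>\<omega>. \<bar>real j * count n j \<omega> / a n - 1\<bar>)) \<longlonglongrightarrow> 0"
proof (rule Lim_null_comparison)
  define r where "r n = real n * p n j / a n" for n
  have r: "r \<longlonglongrightarrow> 1 / real j" unfolding r_def by (rule expected_ratio[OF j])
  have "(\<lambda>n. sqrt ((real j)\<^sup>2 * (r n * (1 / sqrt (a n))\<^sup>2) + (real j * r n - 1)\<^sup>2)) \<longlonglongrightarrow>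
      sqrt ((real j)\<^sup>2 * (1 / real j * 0\<^sup>2) + (real j * (1 / real j) - 1)\<^sup>2)"
    by (intro tendsto_intros r inverse_sqrt_a)
  then show "(\<lambda>n. sqrt ((real j)\<^sup>2 * (r n * (1 / sqrt (a n))\<^sup>2) + (real j * r n - 1)\<^sup>2)) \<longlonglongrightarrow> 0"
    using j by simp
  show "eventually (\<lambda>n. norm (expectation (\<lambda>\<omega>. \<bar>real j * count n j \<omega> / a n - 1\<bar>)) \<le>
     sqrt ((real j)\<^sup>2 * (r n * (1 / sqrt (a n))\<^sup>2) + (real j * r n - 1)\<^sup>2)) sequentially"
  proof (rule eventually_sequentiallyI[of 1])
    fix n :: nat assume n: "n \<ge> 1"
    have a: "0 < a n" by (rule a_pos[OF n])
    have sq: "(real j * count n j \<omega> / a n - 1)\<^sup>2 =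
       (real j / a n)\<^sup>2 * (count n j \<omega>)\<^sup>2 - 2 * real j / a n * count n j \<omega> + 1" for \<omega>
      by (simp add: power2_diff power_mult_distrib power_divide)
    have E1: "expectation (count n j) = real n * p n j"
      unfolding count_def[abs_def] using n j by (simp add: h_Y_integrable expectation_h)
    have "expectation (\<lambda>\<omega>. (real j * count n j \<omega> / a n - 1)\<^sup>2) =
       (real j / a n)\<^sup>2 * (real n * p n j + real n * (real n - 1) * (p n j)\<^sup>2) - 2 * real j / a n * (real n * p n j) + 1"
      unfolding sq
      by (simp add: count_integrable count_square_integrable expectation_count_square[OF n j] E1 prob_space)
    also have "\<dots> = (real j)\<^sup>2 * (r n * (1 / a n)) + (real j * r n - 1)\<^sup>2 - real n * (real j / a n * p n j)\<^sup>2"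
      using a by (simp add: r_def power2_eq_square field_simps)
    \<comment> \<open>The subtracted term comes from the \<open>n * p\<^sup>2\<close> part of the
      binomial variance; it is dropped by its sign.\<close>
    also have "\<dots> \<le> (real j)\<^sup>2 * (r n * (1 / sqrt (a n))\<^sup>2) + (real j * r n - 1)\<^sup>2"
      using a by (simp add: power_divide)
    finally have "sqrt (expectation (\<lambda>\<omega>. (real j * count n j \<omega> / a n - 1)\<^sup>2)) \<le>
        sqrt ((real j)\<^sup>2 * (r n * (1 / sqrt (a n))\<^sup>2) + (real j * r n - 1)\<^sup>2)"
      by (rule real_sqrt_le_mono)
    moreover have "expectation (\<lambda>\<omega>. \<bar>real j * count n j \<omega> / a n - 1\<bar>) \<le> sqrt (expectation (\<lambda>\<omega>. (real j * count n j \<omega> / a n - 1)\<^sup>2))"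
      by (rule expectation_abs_le_sqrt) (simp_all add: sq count_integrable count_square_integrable)
    ultimately have "expectation (\<lambda>\<omega>. \<bar>real j * count n j \<omega> / a n - 1\<bar>) \<le>
        sqrt ((real j)\<^sup>2 * (r n * (1 / sqrt (a n))\<^sup>2) + (real j * r n - 1)\<^sup>2)"
      by linarith
    then show "norm (expectation (\<lambda>\<omega>. \<bar>real j * count n j \<omega> / a n - 1\<bar>)) \<le>
     sqrt ((real j)\<^sup>2 * (r n * (1 / sqrt (a n))\<^sup>2) + (real j * r n - 1)\<^sup>2)"
      by simp
  qed
qed

text \<open>Averaging over \<open>j\<close> preserves convergence in mean. Convergence in mean,
  rather than in probability, lets the bound of \<open>exp_quotient_bound\<close> be integrated
  directly.\<close>

lemma mean_count_L1: "(\<lambda>n. expectation (\<lambda>\<omega>. \<bar>mean_count n \<omega> / a n - 1\<bar>)) \<longlonglongrightarrow> 0"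
proof (rule Lim_null_comparison)
  have "(\<lambda>n. 1 / real k * (\<Sum>j=1..k. expectation (\<lambda>\<omega>. \<bar>real j * count n j \<omega> / a n - 1\<bar>))) \<longlonglongrightarrow> 1 / real k * (\<Sum>j=1..k. 0)"
    by (intro tendsto_intros scaled_count_L1)
  then show "(\<lambda>n. 1 / real k * (\<Sum>j=1..k. expectation (\<lambda>\<omega>. \<bar>real j * count n j \<omega> / a n - 1\<bar>))) \<longlonglongrightarrow> 0" by simp
  show "eventually (\<lambda>n. norm (expectation (\<lambda>\<omega>. \<bar>mean_count n \<omega> / a n - 1\<bar>)) \<le>
     1 / real k * (\<Sum>j=1..k. expectation (\<lambda>\<omega>. \<bar>real j * count n j \<omega> / a n - 1\<bar>))) sequentially"
  proof (intro always_eventually allI)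
    fix n
    have int: "integrable M (\<lambda>\<omega>. real j * count n j \<omega> / a n - 1)" for j
      by (simp add: count_integrable)
    have avg: "mean_count n \<omega> / a n - 1 = 1 / real k * (\<Sum>j=1..k. real j * count n j \<omega> / a n - 1)" for \<omega>
      using k by (simp add: mean_count_def sum_subtractf sum_divide_distrib[symmetric] field_simps)
    have "expectation (\<lambda>\<omega>. \<bar>mean_count n \<omega> / a n - 1\<bar>) \<le>
        expectation (\<lambda>\<omega>. 1 / real k * (\<Sum>j=1..k. \<bar>real j * count n j \<omega> / a n - 1\<bar>))"
    proof (rule integral_mono)
      show "integrable M (\<lambda>\<omega>. \<bar>mean_count n \<omega> / a n - 1\<bar>)"
        unfolding avg by (intro integrable_abs integrable_mult_right Bochner_Integration.integrable_sum int)
      show "\<bar>mean_count n \<omega> / a n - 1\<bar> \<le> 1 / real k * (\<Sum>j=1..k. \<bar>real j * count n j \<omega> / a n - 1\<bar>)" for \<omega>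
        unfolding avg abs_mult using k by (intro mult_mono sum_abs) auto
    qed (intro integrable_abs integrable_mult_right Bochner_Integration.integrable_sum int)
    also have "\<dots> = 1 / real k * (\<Sum>j=1..k. expectation (\<lambda>\<omega>. \<bar>real j * count n j \<omega> / a n - 1\<bar>))"
      using int by (simp add: Bochner_Integration.integral_sum)
    finally show "norm (expectation (\<lambda>\<omega>. \<bar>mean_count n \<omega> / a n - 1\<bar>)) \<le>
      1 / real k * (\<Sum>j=1..k. expectation (\<lambda>\<omega>. \<bar>real j * count n j \<omega> / a n - 1\<bar>))"
      by simp
  qed
qed

section \<open>From the statistic to the limit law\<close>

lemma statistic_eq_scores:
  assumes "n \<ge> 1"
  shows "statistic n \<omega> = (\<Sum>i=1..k-1. (score n (dct k i) \<omega>)\<^sup>2) / (mean_count n \<omega> / a n)"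
proof -
  have "0 < a n" by (rule a_pos[OF assms])
  then have "(\<Sum>i=1..k-1. (score n (dct k i) \<omega>)\<^sup>2) =
      (\<Sum>i=1..k-1. (\<Sum>j=1..k. dct k i j * (real j * count n j \<omega>))\<^sup>2) / a n"
    by (simp add: score_def power_divide flip: sum_divide_distrib)
  also have "\<dots> = (\<Sum>j=1..k. (real j * count n j \<omega> - mean_count n \<omega>)\<^sup>2) / a n"
    by (subst dct_parseval[OF k]) (simp add: mean_count_def)
  \<comment> \<open>Cancelling \<open>a n\<close> is sound also when \<open>mean_count\<close> is 0:
    both quotients are then 0.\<close>
  finally show ?thesis using \<open>0 < a n\<close> by (simp add: statistic_def)
qed

text \<open>Integrating \<open>exp_quotient_bound\<close>, with the scaled denominator as
  \<open>R\<close>, bounds the difference by twice the mean deviation of that denominator from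
  1.\<close>

lemma statistic_laplace_diff:
  assumes s: "0 \<le> s"
  shows "(\<lambda>n. expectation (\<lambda>\<omega>. exp (- (s * statistic n \<omega>))) -
    expectation (\<lambda>\<omega>. exp (- (s * (\<Sum>i=1..k-1. (score n (dct k i) \<omega>)\<^sup>2))))) \<longlonglongrightarrow> 0"
proof (rule Lim_null_comparison)
  show "(\<lambda>n. 2 * expectation (\<lambda>\<omega>. \<bar>mean_count n \<omega> / a n - 1\<bar>)) \<longlonglongrightarrow> 0"
    by (rule tendsto_mult_right_zero[OF mean_count_L1])
  show "eventually (\<lambda>n. norm (expectation (\<lambda>\<omega>. exp (- (s * statistic n \<omega>))) -
    expectation (\<lambda>\<omega>. exp (- (s * (\<Sum>i=1..k-1. (score n (dct k i) \<omega>)\<^sup>2))))) \<le>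
    2 * expectation (\<lambda>\<omega>. \<bar>mean_count n \<omega> / a n - 1\<bar>)) sequentially"
  proof (rule eventually_sequentiallyI[of 1])
    fix n :: nat assume n: "n \<ge> 1"
    define Q where "Q \<omega> = (\<Sum>i=1..k-1. (score n (dct k i) \<omega>)\<^sup>2)" for \<omega>
    have [measurable]: "Q \<in> borel_measurable M" unfolding Q_def[abs_def] by measurable
    have Q0: "0 \<le> Q \<omega>" for \<omega> unfolding Q_def by (intro sum_nonneg) simp
    have i1: "integrable M (\<lambda>\<omega>. exp (- (s * statistic n \<omega>)))"
      using s statistic_nonneg by (intro integrable_const_bound[where B=1]) auto
    have i2: "integrable M (\<lambda>\<omega>. exp (- (s * Q \<omega>)))"
      using s Q0 by (intro integrable_const_bound[where B=1]) auto
    have i3: "integrable M (\<lambda>\<omega>. 2 * \<bar>mean_count n \<omega> / a n - 1\<bar>)"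
      unfolding mean_count_def
      by (intro integrable_mult_right integrable_abs Bochner_Integration.integrable_diff integrable_divide
          Bochner_Integration.integrable_sum count_integrable) simp
    have "\<bar>expectation (\<lambda>\<omega>. exp (- (s * statistic n \<omega>))) - expectation (\<lambda>\<omega>. exp (- (s * Q \<omega>)))\<bar>
      = \<bar>expectation (\<lambda>\<omega>. exp (- (s * statistic n \<omega>)) - exp (- (s * Q \<omega>)))\<bar>"
      using i1 i2 by simp
    also have "\<dots> \<le> expectation (\<lambda>\<omega>. \<bar>exp (- (s * statistic n \<omega>)) - exp (- (s * Q \<omega>))\<bar>)"
      by (rule integral_abs_bound)
    also have "\<dots> \<le> expectation (\<lambda>\<omega>. 2 * \<bar>mean_count n \<omega> / a n - 1\<bar>)"
    proof (rule integral_mono)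
      fix \<omega>
      have "0 \<le> mean_count n \<omega> / a n"
        using a_pos[OF n] mean_count_nonneg by (intro divide_nonneg_pos)
      then show "\<bar>exp (- (s * statistic n \<omega>)) - exp (- (s * Q \<omega>))\<bar> \<le> 2 * \<bar>mean_count n \<omega> / a n - 1\<bar>"
        unfolding statistic_eq_scores[OF n] Q_def[symmetric]
        by (rule exp_quotient_bound[OF s Q0])
    qed (use i1 i2 i3 in auto)
    finally show "norm (expectation (\<lambda>\<omega>. exp (- (s * statistic n \<omega>))) -
      expectation (\<lambda>\<omega>. exp (- (s * (\<Sum>i=1..k-1. (score n (dct k i) \<omega>)\<^sup>2))))) \<le>
      2 * expectation (\<lambda>\<omega>. \<bar>mean_count n \<omega> / a n - 1\<bar>)"
      by (simp add: Q_def)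
  qed
qed

text \<open>With the scores frozen, the Gaussian identity writes the integrand as an average over
  \<open>\<xi>\<close>. After Fubini, \<open>\<xi>\<close> is frozen instead, and
  \<open>score_iexp_limit\<close> gives a pointwise limit. Since \<open>\<xi>\<close> belongs to the
  limit law, integrating this limit yields the required Laplace transform at once.\<close>

lemma scores_laplace_limit:
  fixes M' :: "'c measure" and \<xi> :: "nat \<Rightarrow> 'c \<Rightarrow> real"
  assumes M': "prob_space M'"
    and indep_\<xi>: "prob_space.indep_vars M' (\<lambda>_. borel) \<xi> {1..k-1}"
    and normal: "\<And>i. i \<in> {1..k-1} \<Longrightarrow> distributed M' lborel (\<xi> i) std_normal_density"
    and s: "0 \<le> s"
  shows "(\<lambda>n. expectation (\<lambda>\<omega>. exp (- (s * (\<Sum>i=1..k-1. (score n (dct k i) \<omega>)\<^sup>2))))) \<longlonglongrightarrow>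
    (\<integral>x. exp (- (s * (\<Sum>i=1..k-1. rw_eigenvalue k i * (\<xi> i x)\<^sup>2))) \<partial>M')"
proof -
  interpret M': prob_space M' by fact
  interpret P: pair_prob_space M M' ..
  have \<xi> [measurable]: "\<xi> i \<in> borel_measurable M'" if "i \<in> {1..k-1}" for i
    using indep_\<xi> that by (auto simp: M'.indep_vars_def)
  \<comment> \<open>The factor \<open>sqrt (2 * s)\<close> compensates the 1/2 in the Gaussian
    exponent, so that squares appear with coefficient \<open>s\<close>.\<close>
  define w where "w x j = (\<Sum>i=1..k-1. (sqrt (2 * s) * \<xi> i x) * dct k i j)" for x j
  define \<phi> where "\<phi> n x = (CLINT \<omega>|M. iexp (score n (w x) \<omega>))" for n x
  have score_w: "score n (w x) \<omega> = (\<Sum>i=1..k-1. sqrt (2 * s) * score n (dct k i) \<omega> * \<xi> i x)" for n x \<omega>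
  proof -
    have "(\<Sum>j=1..k. w x j * (real j * count n j \<omega>)) =
       (\<Sum>j=1..k. \<Sum>i=1..k-1. sqrt (2 * s) * \<xi> i x * (dct k i j * (real j * count n j \<omega>)))"
      by (simp only: w_def sum_distrib_right mult.assoc)
    also have "\<dots> = (\<Sum>i=1..k-1. \<Sum>j=1..k. sqrt (2 * s) * \<xi> i x * (dct k i j * (real j * count n j \<omega>)))"
      by (rule sum.swap)
    finally show ?thesis
      by (simp add: score_def sum_divide_distrib sum_distrib_left sum_distrib_right mult_ac)
  qed
  have meas [measurable]: "(\<lambda>(\<omega>, x). score n (w x) \<omega>) \<in> borel_measurable (M \<Otimes>\<^sub>M M')" for n
    unfolding score_w by measurable
  \<comment> \<open>The swapped order serves the measurability of \<open>\<phi> n\<close>, an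
    integral over \<open>M\<close> with parameter \<open>x\<close>.\<close>
  have meas' [measurable]: "(\<lambda>(x, \<omega>). score n (w x) \<omega>) \<in> borel_measurable (M' \<Otimes>\<^sub>M M)" for n
    unfolding score_w by measurable
  have linearise: "complex_of_real (expectation (\<lambda>\<omega>. exp (- (s * (\<Sum>i=1..k-1. (score n (dct k i) \<omega>)\<^sup>2))))) =
      (CLINT x|M'. \<phi> n x)" for n
  proof -
    have "complex_of_real (exp (- (s * (\<Sum>i=1..k-1. (score n (dct k i) \<omega>)\<^sup>2)))) =
       (CLINT x|M'. iexp (score n (w x) \<omega>))" for \<omega>
    proof -
      have "(CLINT x|M'. iexp (score n (w x) \<omega>)) =
        exp (- (\<Sum>i=1..k-1. (sqrt (2 * s) * score n (dct k i) \<omega>)\<^sup>2) / 2)"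
        unfolding score_w by (rule M'.expectation_iexp_normal_combination[OF indep_\<xi> normal])
      also have "- (\<Sum>i=1..k-1. (sqrt (2 * s) * score n (dct k i) \<omega>)\<^sup>2) / 2 =
          - (s * (\<Sum>i=1..k-1. (score n (dct k i) \<omega>)\<^sup>2))"
        using s by (simp add: power_mult_distrib sum_distrib_left[symmetric])
      finally show ?thesis by simp
    qed
    then have "complex_of_real (expectation (\<lambda>\<omega>. exp (- (s * (\<Sum>i=1..k-1. (score n (dct k i) \<omega>)\<^sup>2))))) =
       (CLINT \<omega>|M. CLINT x|M'. iexp (score n (w x) \<omega>))"
      by (simp only: integral_complex_of_real[symmetric])
    also have "\<dots> = (CLINT x|M'. CLINT \<omega>|M. iexp (score n (w x) \<omega>))"
    proof (rule P.Fubini_integral[symmetric])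
      have "integrable (M \<Otimes>\<^sub>M M') (\<lambda>z. iexp (case z of (\<omega>, x) \<Rightarrow> score n (w x) \<omega>))"
        by (rule P.integrable_iexp) simp_all
      then show "integrable (M \<Otimes>\<^sub>M M') (\<lambda>(\<omega>, x). iexp (score n (w x) \<omega>))"
        by (simp add: split_beta')
    qed
    finally show ?thesis by (simp add: \<phi>_def)
  qed
  have "(\<lambda>n. CLINT x|M'. \<phi> n x) \<longlonglongrightarrow>
     (CLINT x|M'. complex_of_real (exp (- (s * (\<Sum>i=1..k-1. rw_eigenvalue k i * (\<xi> i x)\<^sup>2)))))"
  proof (rule integral_dominated_convergence[where w="\<lambda>_. 1"])
    show "\<phi> n \<in> borel_measurable M'" for n
      unfolding \<phi>_def[abs_def] by measurable
    show "(\<lambda>x. complex_of_real (exp (- (s * (\<Sum>i=1..k-1. rw_eigenvalue k i * (\<xi> i x)\<^sup>2))))) \<in> borel_measurable M'"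
      by measurable
    show "AE x in M'. norm (\<phi> n x) \<le> 1" for n
    proof (intro always_eventually allI)
      fix x
      have "norm (\<phi> n x) \<le> expectation (\<lambda>\<omega>. norm (iexp (score n (w x) \<omega>)))"
        unfolding \<phi>_def by (rule integral_norm_bound)
      then show "norm (\<phi> n x) \<le> 1" by (simp add: prob_space)
    qed
    show "AE x in M'. (\<lambda>n. \<phi> n x) \<longlonglongrightarrow> complex_of_real (exp (- (s * (\<Sum>i=1..k-1. rw_eigenvalue k i * (\<xi> i x)\<^sup>2))))"
    proof (intro always_eventually allI)
      fix x
      have "(\<Sum>j=1..k. w x j) = 0"
        unfolding w_def by (subst sum.swap) (simp add: sum_distrib_left[symmetric] sum_dct_eq_0 del: One_nat_def)
      then have "(\<lambda>n. \<phi> n x) \<longlonglongrightarrow> complex_of_real (exp (- (\<Sum>l=1..k. (\<Sum>j=l..k. w x j)\<^sup>2) / 2))"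
        unfolding \<phi>_def by (rule score_iexp_limit)
      \<comment> \<open>The tails of the random weights diagonalise in the cosine basis, which
        produces the eigenvalues.\<close>
      also have "- (\<Sum>l=1..k. (\<Sum>j=l..k. w x j)\<^sup>2) / 2 = - (s * (\<Sum>i=1..k-1. rw_eigenvalue k i * (\<xi> i x)\<^sup>2))"
        unfolding w_def dct_combination_tail_squares
        using s by (simp add: power_mult_distrib sum_distrib_left sum_divide_distrib mult_ac)
      finally show "(\<lambda>n. \<phi> n x) \<longlonglongrightarrow> complex_of_real (exp (- (s * (\<Sum>i=1..k-1. rw_eigenvalue k i * (\<xi> i x)\<^sup>2))))" .
    qed
  qed simp
  then show ?thesis
    unfolding linearise[symmetric] integral_complex_of_real by (simp only: tendsto_of_real_iff)
qed

text \<open>Both laws live on the half-line, so the Laplace transforms at natural numbers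
  decide.\<close>

theorem statistic_weak_conv:
  fixes M' :: "'c measure" and \<xi> :: "nat \<Rightarrow> 'c \<Rightarrow> real"
  assumes M': "prob_space M'"
    and indep_\<xi>: "prob_space.indep_vars M' (\<lambda>_. borel) \<xi> {1..k-1}"
    and normal: "\<And>i. i \<in> {1..k-1} \<Longrightarrow> distributed M' lborel (\<xi> i) std_normal_density"
  shows "weak_conv_m (\<lambda>n. distr M borel (statistic n))
    (distr M' borel (\<lambda>x. \<Sum>i=1..k-1. rw_eigenvalue k i * (\<xi> i x)\<^sup>2))"
proof -
  interpret M': prob_space M' by fact
  have \<xi> [measurable]: "\<xi> i \<in> borel_measurable M'" if "i \<in> {1..k-1}" for i
    using indep_\<xi> that by (auto simp: M'.indep_vars_def)
  have Z [measurable]: "(\<lambda>x. \<Sum>i=1..k-1. rw_eigenvalue k i * (\<xi> i x)\<^sup>2) \<in> borel_measurable M'"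
    by measurable
  show ?thesis
  proof (rule weak_conv_m_of_laplace)
    show "real_distribution (distr M borel (statistic n))" for n
      by (rule real_distribution_distr) simp
    show "real_distribution (distr M' borel (\<lambda>x. \<Sum>i=1..k-1. rw_eigenvalue k i * (\<xi> i x)\<^sup>2))"
      by (rule M'.real_distribution_distr) simp
    show "AE x in distr M borel (statistic n). 0 \<le> x" for n
      by (subst AE_distr_iff) (auto simp: statistic_nonneg)
    show "AE x in distr M' borel (\<lambda>x. \<Sum>i=1..k-1. rw_eigenvalue k i * (\<xi> i x)\<^sup>2). 0 \<le> x"
      by (subst AE_distr_iff[OF Z]) (auto simp: rw_eigenvalue_def intro!: sum_nonneg)
    fix s :: nat
    have "(\<lambda>n. expectation (\<lambda>\<omega>. exp (- (real s * statistic n \<omega>)))) \<longlonglongrightarrow>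
      (\<integral>x. exp (- (real s * (\<Sum>i=1..k-1. rw_eigenvalue k i * (\<xi> i x)\<^sup>2))) \<partial>M')"
      using Lim_transform[OF scores_laplace_limit[OF M' indep_\<xi> normal] statistic_laplace_diff] by simp
    then show "(\<lambda>n. \<integral>x. exp (- (real s * x)) \<partial>distr M borel (statistic n)) \<longlonglongrightarrow>
      (\<integral>x. exp (- (real s * x)) \<partial>distr M' borel (\<lambda>x. \<Sum>i=1..k-1. rw_eigenvalue k i * (\<xi> i x)\<^sup>2))"
      by (simp add: integral_distr del: One_nat_def)
  qed
qed

end

subsection \<open>Exceedances under a copula\<close>

text \<open>A sum of indicators vanishes only if each does. Thus the complement of an exceedance is
  a lower orthant with corner on the diagonal, where the copula gives its probability.\<close>

lemma exceedances_pos_iff: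
  fixes x :: "real ^ 'd"
  shows "0 < exceedances x s \<longleftrightarrow> \<not> x \<le> 1 + s *\<^sub>R 1"
proof -
  have "exceedances x s = (\<Sum>i\<in>UNIV. if x $ i \<le> 1 + s then 0 else 1)"
    unfolding exceedances_def by (rule sum.cong) (auto simp: indicator_def)
  moreover have "(\<Sum>i\<in>UNIV. if x $ i \<le> 1 + s then 0 else 1 :: real) = 0 \<longleftrightarrow> (\<forall>i. x $ i \<le> 1 + s)"
    by (subst sum_nonneg_eq_0_iff) auto
  moreover have "0 \<le> (\<Sum>i\<in>UNIV. if x $ i \<le> 1 + s then 0 else 1 :: real)"
    by (rule sum_nonneg) simp
  ultimately show ?thesis
    unfolding less_eq_vec_def by fastforce
qed

lemma is_norm_one_pos:
  fixes N :: "real ^ 'd \<Rightarrow> real"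
  assumes "is_norm N"
  shows "0 < N 1"
proof -
  have "(1 :: real ^ 'd) \<noteq> 0" by (simp add: vec_eq_iff)
  then show ?thesis using assms unfolding is_norm_def by (metis less_le)
qed

text \<open>On the diagonal \<open>u - 1\<close> is \<open>- t\<close> times the vector 1, so
  homogeneity of the norm turns the expansion of \<open>C\<close> into one in powers of
  \<open>t\<close>.\<close>

lemma diagonal_copula_expansion:
  fixes C N :: "real ^ 'd \<Rightarrow> real" and t :: "nat \<Rightarrow> real"
  assumes N: "is_norm N"
    and O: "(\<lambda>u. C u - (1 - N (u - 1))) \<in> O[at 1 within {0..1}](\<lambda>u. N (u - 1) powr (1 + \<delta>))"
    and t0: "t \<longlonglongrightarrow> 0" and t: "eventually (\<lambda>n. 0 < t n \<and> t n < 1) sequentially"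
  obtains K where "eventually (\<lambda>n. \<bar>(1 - C (1 + (- t n) *\<^sub>R 1)) - t n * N 1\<bar> \<le> K * t n powr (1 + \<delta>)) sequentially"
proof -
  define u :: "nat \<Rightarrow> real ^ 'd" where "u n = 1 + (- t n) *\<^sub>R 1" for n
  have "u \<longlonglongrightarrow> 1 + (- 0) *\<^sub>R 1"
    unfolding u_def by (intro tendsto_intros t0)
  \<comment> \<open>Positive \<open>t n\<close> avoids the point 1, which the filter excludes, and
    \<open>t n < 1\<close> keeps \<open>u n\<close> in the cube.\<close>
  moreover have "eventually (\<lambda>n. u n \<in> {0..1} \<and> u n \<noteq> 1) sequentially"
    using t by eventually_elim (auto simp: u_def less_eq_vec_def vec_eq_iff)
  ultimately have u: "filterlim u (at 1 within {0..1}) sequentially"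
    by (simp add: filterlim_at)
  obtain B where "eventually (\<lambda>v. norm (C v - (1 - N (v - 1))) \<le> B * norm (N (v - 1) powr (1 + \<delta>))) (at 1 within {0..1})"
    using landau_o.bigE[OF O] by blast
  then have "eventually (\<lambda>n. norm (C (u n) - (1 - N (u n - 1))) \<le> B * norm (N (u n - 1) powr (1 + \<delta>))) sequentially"
    using u by (rule eventually_compose_filterlim)
  then have "eventually (\<lambda>n. \<bar>(1 - C (1 + (- t n) *\<^sub>R 1)) - t n * N 1\<bar> \<le> B * N 1 powr (1 + \<delta>) * t n powr (1 + \<delta>)) sequentially"
    using t
  proof eventually_elim
    case (elim n)
    have "u n - 1 = (- t n) *\<^sub>R 1" by (simp add: u_def)
    moreover have "N ((- t n) *\<^sub>R 1) = \<bar>- t n\<bar> * N 1"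
      using N unfolding is_norm_def by blast
    ultimately have Nu: "N (u n - 1) = t n * N 1" using elim by simp
    show ?case
      using elim(1) elim(2) is_norm_one_pos[OF N] unfolding u_def[symmetric] Nu
      by (simp add: powr_mult mult_ac)
  qed
  then show ?thesis by (rule that)
qed

section \<open>The copula sample as an instance of nested indicators\<close>

theorem theorem4p1:
  fixes C :: "real ^ 'd \<Rightarrow> real"
    and N :: "real ^ 'd \<Rightarrow> real"
    and \<delta> :: real
    and M :: "'a measure"
    and U :: "nat \<Rightarrow> 'a \<Rightarrow> real ^ 'd"
    and k :: nat
    and c :: "nat \<Rightarrow> real"
    and M' :: "'b measure"
    and \<xi> :: "nat \<Rightarrow> 'b \<Rightarrow> real"
  assumes "copula C"
    and "prob_space M"
    and "prob_space.indep_vars M (\<lambda>_. borel) U {1..}"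
    and "\<And>i. i \<ge> 1 \<Longrightarrow> mv_cdf (distr M borel (U i)) = C"
    and "\<delta> > 0"
    and "D_norm N"
    and "(\<lambda>u. C u - (1 - N (u - 1))) \<in> O[at 1 within {0..1}](\<lambda>u. N (u - 1) powr (1 + \<delta>))"
    and "k \<ge> 1"
    and "\<And>n. n \<ge> 1 \<Longrightarrow> 0 < c n \<and> c n < 1"
    and "c \<longlonglongrightarrow> 0"
    and "filterlim (\<lambda>n. real n * c n) at_top sequentially"
    and "(\<lambda>n. real n * c n powr (1 + 2 * \<delta>)) \<longlonglongrightarrow> 0"
    and "prob_space M'"
    and "prob_space.indep_vars M' (\<lambda>_. borel) \<xi> {1..k - 1}"
    and "\<And>i. i \<in> {1..k - 1} \<Longrightarrow> distributed M' lborel (\<xi> i) std_normal_density"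
  shows "weak_conv_m
    (\<lambda>n. distr M borel (\<lambda>\<omega>. T_stat k n (c n) (\<lambda>i. U i \<omega>)))
    (distr M' borel (\<lambda>\<omega>. \<Sum>i=1..k - 1.
        1 / (4 * (sin (real i / real k * (pi / 2)))\<^sup>2) * (\<xi> i \<omega>)\<^sup>2))"
proof -
  interpret prob_space M by fact
  have N: "is_norm N" using \<open>D_norm N\<close> by (simp add: D_norm_def)
  define m where "m = N 1"
  have m: "0 < m" unfolding m_def by (rule is_norm_one_pos[OF N])
  define v :: "nat \<Rightarrow> nat \<Rightarrow> real ^ 'd" where "v n j = 1 + (- (c n / real j)) *\<^sub>R 1" for n j
  define h where "h n j = (indicator (- {..v n j}) :: real ^ 'd \<Rightarrow> real)" for n j
  define p where "p n j = 1 - C (v n j)" for n j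
  \<comment> \<open>To first order \<open>p n j\<close> is \<open>m * c n / j\<close>, so
    \<open>a n\<close> is the common leading value of \<open>n * j * p n j\<close> for all
    \<open>j\<close>.\<close>
  define a where "a n = m * (real n * c n)" for n
  have c: "0 < c n" "c n < 1" if "n \<ge> 1" for n using assms(9)[OF that] by auto
  have U [measurable]: "U i \<in> borel_measurable M" if "i \<ge> 1" for i
    using assms(3) that by (auto simp: indep_vars_def)
  have [measurable]: "{..u} \<in> sets borel" for u :: "real ^ 'd"
    by (rule borel_closed) (rule closed_eucl_atMost)
  interpret nested_indicators M borel U h p a k
  proof
    show "indep_vars (\<lambda>_. borel) U {1..}" by fact
    show "h n j \<in> borel_measurable borel" for n j
      unfolding h_def by measurable
    show "h n j y \<in> {0, 1}" for n j y by (auto simp: h_def indicator_def)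
    show "h n i y * h n j y = h n (max i j) y" if "n \<ge> 1" "i \<in> {1..k}" "j \<in> {1..k}" for n i j y
    proof -
      \<comment> \<open>Thresholds rise with the index, so exceeding the one of larger index implies
        exceeding the other.\<close>
      have v_mono: "v n l \<le> v n l'" if "1 \<le> l" "l \<le> l'" for l l'
        using that c[OF \<open>n \<ge> 1\<close>] by (simp add: v_def less_eq_vec_def frac_le)
      have "v n (min i j) \<le> v n (max i j)" using that by (intro v_mono) auto
      then have "h n (min i j) y * h n (max i j) y = h n (max i j) y"
        by (auto simp: h_def indicator_def intro: order_trans)
      then show ?thesis by (cases "i \<le> j") (simp_all add: mult.commute)
    qed
    show "expectation (\<lambda>\<omega>. h n j (U i \<omega>)) = p n j" if "n \<ge> 1" "i \<ge> 1" "j \<in> {1..k}" for n i j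
    proof -
      interpret D: prob_space "distr M borel (U i)" by (rule prob_space_distr) (rule U[OF that(2)])
      have "expectation (\<lambda>\<omega>. h n j (U i \<omega>)) = (\<integral>y. h n j y \<partial>distr M borel (U i))"
        unfolding h_def by (rule integral_distr[OF U[OF that(2)], symmetric]) measurable
      also have "\<dots> = measure (distr M borel (U i)) (space (distr M borel (U i)) - {..v n j})"
        by (simp add: h_def Compl_eq_Diff_UNIV)
      also have "\<dots> = 1 - mv_cdf (distr M borel (U i)) (v n j)"
        by (subst D.prob_compl) (simp_all add: mv_cdf_def)
      finally show ?thesis using assms(4)[OF that(2)] by (simp add: p_def)
    qed
    show "0 < a n" if "n \<ge> 1" for n using that c[OF that] m by (simp add: a_def)
    show "filterlim a at_top sequentially"
      unfolding a_def by (rule filterlim_tendsto_pos_mult_at_top[OF tendsto_const m assms(11)])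
    show "(\<lambda>n. (real n * (real j * p n j) - a n) / sqrt (a n)) \<longlonglongrightarrow> 0" if j: "j \<in> {1..k}" for j
    proof -
      obtain K where K: "eventually (\<lambda>n. \<bar>(1 - C (1 + (- (c n / real j)) *\<^sub>R 1)) - c n / real j * N 1\<bar>
          \<le> K * (c n / real j) powr (1 + \<delta>)) sequentially"
      proof (rule diagonal_copula_expansion[OF N assms(7)])
        show "(\<lambda>n. c n / real j) \<longlonglongrightarrow> 0"
          using tendsto_divide[OF assms(10) tendsto_const[of "real j"]] j by simp
        show "eventually (\<lambda>n. 0 < c n / real j \<and> c n / real j < 1) sequentially"
        proof (rule eventually_sequentiallyI[of 1])
          fix n :: nat assume "n \<ge> 1"
          then show "0 < c n / real j \<and> c n / real j < 1" using c[of n] j by (auto simp: field_simps)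
        qed
      qed
      \<comment> \<open>Here \<open>n * c n powr (1 + \<delta>)\<close> over
        \<open>sqrt (n * c n)\<close> equals \<open>sqrt (n * c n powr (1 + 2 * \<delta>))\<close>,
        the quantity assumed to vanish under the root.\<close>
      define b where "b n = real j * \<bar>K\<bar> / sqrt m * sqrt (real n * c n powr (1 + 2 * \<delta>))" for n
      have "b \<longlonglongrightarrow> real j * \<bar>K\<bar> / sqrt m * sqrt 0"
        unfolding b_def by (intro tendsto_intros assms(12))
      then have "b \<longlonglongrightarrow> 0" by simp
      moreover have "eventually (\<lambda>n. norm ((real n * (real j * p n j) - a n) / sqrt (a n)) \<le> b n) sequentially"
        using K eventually_ge_at_top[of 1]
      proof eventually_elim
        case (elim n)
        note cn = c[OF elim(2)]
        have n: "0 < real n" using elim by simp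
        have "real n * (real j * p n j) - a n = real n * real j * (p n j - c n / real j * m)"
          using j by (simp add: a_def algebra_simps)
        then have "\<bar>real n * (real j * p n j) - a n\<bar> = real n * real j * \<bar>p n j - c n / real j * m\<bar>"
          by (simp add: abs_mult)
        also have "\<dots> \<le> real n * real j * (\<bar>K\<bar> * c n powr (1 + \<delta>))"
        proof (intro mult_left_mono)
          have "\<bar>p n j - c n / real j * m\<bar> \<le> K * (c n / real j) powr (1 + \<delta>)"
            using elim by (simp add: p_def v_def m_def)
          \<comment> \<open>\<open>K\<close> has unknown sign, hence its absolute value;
            \<open>c n / j\<close> is at most \<open>c n\<close> because \<open>j\<close> is at
            least 1.\<close>
          also have "\<dots> \<le> \<bar>K\<bar> * c n powr (1 + \<delta>)"
            using cn j \<open>\<delta> > 0\<close> by (intro mult_mono powr_mono2) (auto simp: field_simps)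
          finally show "\<bar>p n j - c n / real j * m\<bar> \<le> \<bar>K\<bar> * c n powr (1 + \<delta>)" .
        qed simp_all
        finally have "\<bar>real n * (real j * p n j) - a n\<bar> / sqrt (a n) \<le>
            real n * real j * (\<bar>K\<bar> * c n powr (1 + \<delta>)) / sqrt (a n)"
          using \<open>0 < m\<close> n cn by (intro divide_right_mono) (auto simp: a_def)
        also have "\<dots> = b n"
        proof -
          have "(c n powr (1 + \<delta>))\<^sup>2 = c n * c n powr (1 + 2 * \<delta>)"
            using cn by (simp add: power2_eq_square powr_add[symmetric] powr_mult_base)
          then have "(real n * c n powr (1 + \<delta>))\<^sup>2 = real n * c n * (real n * c n powr (1 + 2 * \<delta>))"
            by (simp add: power_mult_distrib power2_eq_square mult_ac)
          then have "sqrt (real n * c n) * sqrt (real n * c n powr (1 + 2 * \<delta>)) = sqrt ((real n * c n powr (1 + \<delta>))\<^sup>2)"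
            by (simp only: real_sqrt_mult)
          also have "\<dots> = real n * c n powr (1 + \<delta>)" using n by simp
          finally have "real n * c n powr (1 + \<delta>) = sqrt (real n * c n) * sqrt (real n * c n powr (1 + 2 * \<delta>))" ..
          moreover have "sqrt (a n) = sqrt m * sqrt (real n * c n)" by (simp add: a_def real_sqrt_mult)
          moreover have "0 < sqrt (real n * c n)" using n cn by simp
          ultimately show ?thesis using m by (simp add: b_def field_simps)
        qed
        finally show ?case using m n cn by (simp add: abs_divide a_def)
      qed
      ultimately show ?thesis by (rule Lim_null_comparison[rotated])
    qed
    show "k \<ge> 1" by fact
  qed
  have "exceedance_count (\<lambda>i. U i \<omega>) n (c n) j = count n j \<omega>" for n j \<omega>
    by (simp add: exceedance_count_def count_def h_def indicator_def exceedances_pos_iff v_def)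
  then have "T_stat k n (c n) (\<lambda>i. U i \<omega>) = statistic n \<omega>" for n \<omega>
    by (simp add: T_stat_def statistic_def mean_count_def Let_def)
  then show ?thesis
    using statistic_weak_conv[OF assms(13-15)] by (simp add: rw_eigenvalue_def)
qed

end
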